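(* Let $f\in L^2(\Omega)$. Let $\{\widetilde V_h\}_{h\to0}$ be a family of finite dimensional subspaces of $H^1_0(\Omega)$ (indexed by values $h>0$ tending to $0$) for which there are operators $\widetilde{\mathcal I}_h:H^1_0(\Omega)\to\widetilde V_h$ with $\|\widetilde{\mathcal I}_hv-v\|_1\to0$ as $h\to0$ for every $v\in H^1_0(\Omega)$. Let $\{\widetilde u_h\}_{h\to0}$, $\widetilde u_h\in\widetilde V_h$, be a sequence of Galerkin approximations, i.e. $$a(\widetilde u_h;\widetilde u_h,\widetilde v_h)=\ell(\widetilde v_h)\quad\text{for all }\widetilde v_h\in\widetilde V_h.$$ Then there exist a subsequence $\{\widetilde u_{\bar h}\}\subset\{\widetilde u_h\}$ and an element $u\in H^1_0(\Omega)$ such that $\widetilde u_{\bar h}\rightharpoonup u$ weakly in $H^1_0(\Omega)$ as $\bar h\to0$, and $u$ satisfies $a(u;u,w)=\ell(w)$ for every $w\in H^1_0(\Omega)$.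
   Context: $\Omega=(0,L)\subset\mathbb{R}$; interfaces $\Gamma=\{\gamma_1<\dots<\gamma_{m_\Gamma}\}\subset\Omega$; $\Omega_0=(0,\gamma_1)$, $\Omega_j=(\gamma_j,\gamma_{j+1})$ for $1\le j\le m_\Gamma-1$, $\Omega_{m_\Gamma}=(\gamma_{m_\Gamma},L)$. For each $j=0,\dots,m_\Gamma$ there are constants $0<\kappa_{j,\min}\le\kappa_{j,\max}<\infty$ and $C_{L,j}$, and a function $\kappa_j\in C(\overline\Omega_j\times\mathbb{R})$ with values in $[\kappa_{j,\min},\kappa_{j,\max}]$ such that $|\kappa_j(x,\zeta_1)-\kappa_j(x,\zeta_2)|\le C_{L,j}|\zeta_1-\zeta_2|$ for all $x\in\Omega_j$, $\zeta_1,\zeta_2\in\mathbb{R}$. Forms: $a(v;u,w)=\sum_{j=0}^{m_\Gamma}\int_{\Omega_j}\kappa_j(x,v(x))u'(x)w'(x)\,dx$ and $\ell(w)=\int_\Omega f(x)w(x)\,dx$. $\|\cdot\|_1$ is the $H^1(\Omega)$ norm. *)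

theory Defs
  imports "HOL-Analysis.Analysis"
begin

text \<open>
  Elements of Lebesgue and Sobolev spaces are represented by functions
  \<^typ>\<open>real \<Rightarrow> real\<close>, two of which stand for the same element of a space over \<open>S\<close>
  if they agree almost everywhere on \<open>S\<close>.
\<close>

definition L2 :: "real set \<Rightarrow> (real \<Rightarrow> real) set" where
  "L2 S = {f. f \<in> borel_measurable (lebesgue_on S) \<and> integrable (lebesgue_on S) (\<lambda>x. (f x)\<^sup>2)}"

text \<open>The space of smooth functions with compact support in the open set \<open>S\<close>.\<close>

definition test_functions :: "real set \<Rightarrow> (real \<Rightarrow> real) set" where
  "test_functions S = {\<phi>. (\<forall>n. (deriv ^^ n) \<phi> differentiable_on UNIV)
      \<and> compact (closure {x. \<phi> x \<noteq> 0}) \<and> closure {x. \<phi> x \<noteq> 0} \<subseteq> S}"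

definition has_weak_deriv :: "real set \<Rightarrow> (real \<Rightarrow> real) \<Rightarrow> (real \<Rightarrow> real) \<Rightarrow> bool" where
  "has_weak_deriv S u g \<longleftrightarrow> (\<forall>\<phi>\<in>test_functions S.
      (LINT x|lebesgue_on S. u x * deriv \<phi> x) = - (LINT x|lebesgue_on S. g x * \<phi> x))"

definition H1 :: "real set \<Rightarrow> (real \<Rightarrow> real) set" where
  "H1 S = {u \<in> L2 S. \<exists>g\<in>L2 S. has_weak_deriv S u g}"

text \<open>
  The weak derivative is determined up to a null set only, so a representative is chosen.
  It is meaningful only for \<open>u \<in> H1 S\<close>.
\<close>

definition weak_deriv :: "real set \<Rightarrow> (real \<Rightarrow> real) \<Rightarrow> real \<Rightarrow> real" where
  "weak_deriv S u = (SOME g. g \<in> L2 S \<and> has_weak_deriv S u g)"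

definition H1_norm :: "real set \<Rightarrow> (real \<Rightarrow> real) \<Rightarrow> real" where
  "H1_norm S u =
     sqrt ((LINT x|lebesgue_on S. (u x)\<^sup>2) + (LINT x|lebesgue_on S. (weak_deriv S u x)\<^sup>2))"

text \<open>The closure of the test functions in the \<open>H1\<close> norm.\<close>

definition H10 :: "real set \<Rightarrow> (real \<Rightarrow> real) set" where
  "H10 S = {u \<in> H1 S. \<forall>\<epsilon>>0. \<exists>\<phi>\<in>test_functions S. H1_norm S (\<lambda>x. u x - \<phi> x) < \<epsilon>}"

text \<open>
  The bound forces \<open>F\<close> to agree on almost everywhere equal functions, so these are exactly
  the elements of the dual space of \<open>H10 S\<close>. Values of \<open>F\<close> outside \<open>H10 S\<close> are irrelevant.
\<close>

definition bounded_functional_H10 :: "real set \<Rightarrow> ((real \<Rightarrow> real) \<Rightarrow> real) \<Rightarrow> bool" where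
  "bounded_functional_H10 S F \<longleftrightarrow>
     (\<forall>v\<in>H10 S. \<forall>w\<in>H10 S. F (\<lambda>x. v x + w x) = F v + F w) \<and>
     (\<forall>c. \<forall>v\<in>H10 S. F (\<lambda>x. c * v x) = c * F v) \<and>
     (\<exists>C. \<forall>v\<in>H10 S. \<bar>F v\<bar> \<le> C * H1_norm S v)"

definition weakly_converges_H10 ::
    "real set \<Rightarrow> (nat \<Rightarrow> real \<Rightarrow> real) \<Rightarrow> (real \<Rightarrow> real) \<Rightarrow> bool" where
  "weakly_converges_H10 S U u \<longleftrightarrow> (\<forall>n. U n \<in> H10 S) \<and> u \<in> H10 S \<and>
     (\<forall>F. bounded_functional_H10 S F \<longrightarrow> (\<lambda>n. F (U n)) \<longlonglongrightarrow> F u)"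

text \<open>
  Finite dimension is required modulo almost everywhere equality. Hence \<open>V\<close> may contain
  all representatives of its elements, or only some (for instance the continuous ones).
\<close>

definition findim_subspace_H10 :: "real set \<Rightarrow> (real \<Rightarrow> real) set \<Rightarrow> bool" where
  "findim_subspace_H10 S V \<longleftrightarrow> V \<subseteq> H10 S \<and> (\<lambda>x. 0) \<in> V \<and>
     (\<forall>v\<in>V. \<forall>w\<in>V. (\<lambda>x. v x + w x) \<in> V) \<and>
     (\<forall>c. \<forall>v\<in>V. (\<lambda>x. c * v x) \<in> V) \<and>
     (\<exists>B. finite B \<and> B \<subseteq> V \<and>
        (\<forall>v\<in>V. \<exists>c. AE x in lebesgue_on S. v x = (\<Sum>b\<in>B. c b * b x)))"

text \<open>
  The interfaces are \<open>\<gamma> 1 < \<dots> < \<gamma> m\<close>; the other values of \<open>\<gamma>\<close> are not used.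
  With \<open>m = 0\<close> there is no interface and the only subdomain is \<open>(0, L)\<close>.
\<close>

definition node :: "real \<Rightarrow> nat \<Rightarrow> (nat \<Rightarrow> real) \<Rightarrow> nat \<Rightarrow> real" where
  "node L m \<gamma> j = (if j = 0 then 0 else if j \<le> m then \<gamma> j else L)"

definition subdomain :: "real \<Rightarrow> nat \<Rightarrow> (nat \<Rightarrow> real) \<Rightarrow> nat \<Rightarrow> real set" where
  "subdomain L m \<gamma> j = {node L m \<gamma> j <..< node L m \<gamma> (Suc j)}"

definition form_a :: "real \<Rightarrow> nat \<Rightarrow> (nat \<Rightarrow> real) \<Rightarrow> (nat \<Rightarrow> real \<Rightarrow> real \<Rightarrow> real) \<Rightarrow>
    (real \<Rightarrow> real) \<Rightarrow> (real \<Rightarrow> real) \<Rightarrow> (real \<Rightarrow> real) \<Rightarrow> real" where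
  "form_a L m \<gamma> \<kappa> v u w = (\<Sum>j=0..m. LINT x|lebesgue_on (subdomain L m \<gamma> j).
     \<kappa> j x (v x) * weak_deriv {0<..<L} u x * weak_deriv {0<..<L} w x)"

definition form_l :: "real \<Rightarrow> (real \<Rightarrow> real) \<Rightarrow> (real \<Rightarrow> real) \<Rightarrow> real" where
  "form_l L f w = (LINT x|lebesgue_on {0<..<L}. f x * w x)"

end

(*
  In one dimension weak compactness can be avoided. The Galerkin solutions u_h are bounded in H10,
  hence uniformly Hoelder continuous, and by Arzela-Ascoli a subsequence converges uniformly to some
  G. Let A(x) = kappa(x, G(x)) be the frozen limit coefficient. The linear problem with coefficient A
  is solved explicitly by w(x) = int_0^x (c - F)/A, where F is a primitive of f and c is chosen such
  that w(L) = 0. Since kappa(., u_h) converges uniformly to A, an estimate in the style of Cea's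
  lemma shows that u_h converges to w strongly in H1. Therefore G = w, and w solves the nonlinear
  problem.
*)
theory Submission
  imports Defs "HOL-Complex_Analysis.Great_Picard" "HOL-Real_Asymp.Real_Asymp"
begin

section \<open>Smooth functions\<close>

text \<open>Functions in \<open>H10\<close> are given only up to null sets and
  \<open>weak_deriv\<close> is a chosen representative, so Hoelder continuity and pointwise limits
  have no direct meaning for them. The bridge is \<open>prim\<close>: each u in \<open>H10\<close>
  agrees almost everywhere with the primitive of its weak derivative, which has mean zero, and
  conversely \<open>prim g\<close> lies in \<open>H10\<close> for every bounded measurable g of mean
  zero. Boundedness is harmless here: the flux c - F is bounded because F is a primitive of an L2
  function, and the coefficient stays above a positive constant. Convergence is therefore argued for
  derivatives in L2; \<open>prim\<close> carries it over to the functions with the Poincare factor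
  L. The approximation property of the spaces enters once, applied to that one solution.\<close>

definition smooth_real :: "(real \<Rightarrow> real) \<Rightarrow> bool" where
  "smooth_real f \<longleftrightarrow> (\<forall>n. (deriv ^^ n) f differentiable_on UNIV)"

text \<open>\<open>deriv\<close> is a total operator, so smoothness is a greatest fixed point: a set
  of differentiable functions that \<open>deriv\<close> maps into itself contains only smooth
  functions. This avoids formulas for higher derivatives.\<close>

lemma smooth_real_coinduct:
  assumes "f \<in> C" and "\<And>f. f \<in> C \<Longrightarrow> f differentiable_on UNIV \<and> deriv f \<in> C"
  shows "smooth_real f"
proof -
  have "(deriv ^^ n) f \<in> C" for n
    by (induction n) (use assms in auto)
  then show ?thesis
    using assms(2) by (auto simp: smooth_real_def)
qed

lemma smooth_real_deriv: "smooth_real f \<Longrightarrow> smooth_real (deriv f)"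
  unfolding smooth_real_def
proof (intro allI)
  fix n
  assume "\<forall>n. (deriv ^^ n) f differentiable_on UNIV"
  then have "(deriv ^^ Suc n) f differentiable_on UNIV" by blast
  then show "(deriv ^^ n) (deriv f) differentiable_on UNIV"
    by (simp only: funpow_Suc_right comp_apply)
qed

lemma smooth_real_has_deriv:
  assumes "smooth_real f"
  shows "(f has_real_derivative deriv f x) (at x)"
proof -
  have "(deriv ^^ 0) f differentiable_on UNIV"
    using assms unfolding smooth_real_def by blast
  then show ?thesis
    by (simp add: differentiable_on_def DERIV_deriv_iff_real_differentiable)
qed

text \<open>The smooth functions together with \<open>F\<close> form a set that \<open>deriv\<close>
  maps into itself.\<close>

lemma smooth_real_antideriv:
  assumes "\<And>x. (F has_real_derivative f x) (at x)" and "smooth_real f"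
  shows "smooth_real F"
proof (rule smooth_real_coinduct[of F "insert F {f. smooth_real f}"])
  have "deriv F = f"
    using assms(1) by (intro ext DERIV_imp_deriv)
  moreover have "G differentiable_on UNIV" if "smooth_real G" for G
    using that smooth_real_def[of G] by (metis funpow_0)
  moreover have "F differentiable_on UNIV"
    using assms(1) by (auto simp: differentiable_on_def real_differentiable_def)
  ultimately show "g differentiable_on UNIV \<and> deriv g \<in> insert F {f. smooth_real f}"
    if "g \<in> insert F {f. smooth_real f}" for g
    using that assms(2) smooth_real_deriv by auto
qed simp

text \<open>The product of two smooth functions is smooth because its derivative is again a sum of such
  products, so the coinduction needs a set that is closed under sums and products.\<close>

inductive_set smooth_closure :: "(real \<Rightarrow> real) set" where
  base: "smooth_real f \<Longrightarrow> f \<in> smooth_closure"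
| const: "(\<lambda>x. c) \<in> smooth_closure"
| ident: "(\<lambda>x. x) \<in> smooth_closure"
| add: "f \<in> smooth_closure \<Longrightarrow> g \<in> smooth_closure \<Longrightarrow> (\<lambda>x. f x + g x) \<in> smooth_closure"
| mult: "f \<in> smooth_closure \<Longrightarrow> g \<in> smooth_closure \<Longrightarrow> (\<lambda>x. f x * g x) \<in> smooth_closure"

lemma smooth_closure_smooth:
  assumes "f \<in> smooth_closure"
  shows "smooth_real f"
proof (rule smooth_real_coinduct[OF assms])
  fix f
  assume "f \<in> smooth_closure"
  then have "(\<forall>x. (f has_real_derivative deriv f x) (at x)) \<and> deriv f \<in> smooth_closure"
  proof induction
    case (base f)
    then show ?case
      by (auto intro: smooth_closure.base smooth_real_deriv smooth_real_has_deriv)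
  next
    case (const c)
    then show ?case by (auto intro: smooth_closure.const)
  next
    case ident
    then show ?case by (auto intro: smooth_closure.const)
  next
    case (add f g)
    have d: "((\<lambda>x. f x + g x) has_real_derivative deriv f x + deriv g x) (at x)" for x
      using add by (auto intro!: derivative_eq_intros)
    then have "deriv (\<lambda>x. f x + g x) = (\<lambda>x. deriv f x + deriv g x)"
      by (intro ext DERIV_imp_deriv)
    with d add show ?case by (auto intro: smooth_closure.add)
  next
    case (mult f g)
    have d: "((\<lambda>x. f x * g x) has_real_derivative deriv f x * g x + f x * deriv g x) (at x)" for x
    proof -
      have "(f has_real_derivative deriv f x) (at x)" "(g has_real_derivative deriv g x) (at x)"
        using mult by auto
      from DERIV_mult[OF this] show ?thesis by (simp add: algebra_simps)
    qed
    then have "deriv (\<lambda>x. f x * g x) = (\<lambda>x. deriv f x * g x + f x * deriv g x)"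
      by (intro ext DERIV_imp_deriv)
    with d mult show ?case by (auto intro: smooth_closure.intros)
  qed
  then show "f differentiable_on UNIV \<and> deriv f \<in> smooth_closure"
    by (auto simp: differentiable_on_def real_differentiable_def)
qed

lemma smooth_real_const: "smooth_real (\<lambda>x. c)"
  and smooth_real_ident: "smooth_real (\<lambda>x. x)"
  by (rule smooth_closure_smooth[OF smooth_closure.const] smooth_closure_smooth[OF smooth_closure.ident])+

lemma smooth_real_add: "smooth_real f \<Longrightarrow> smooth_real g \<Longrightarrow> smooth_real (\<lambda>x. f x + g x)"
  and smooth_real_mult: "smooth_real f \<Longrightarrow> smooth_real g \<Longrightarrow> smooth_real (\<lambda>x. f x * g x)"
  by (auto intro: smooth_closure_smooth smooth_closure.intros)

text \<open>Lets Stone-Weierstrass replace convolution with a mollifier when test functions are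
  constructed.\<close>

lemma smooth_real_polynomial_function:
  fixes p :: "real \<Rightarrow> real"
  assumes "real_polynomial_function p"
  shows "smooth_real p"
  using assms
proof induction
  case (linear f)
  then obtain c where "f = (\<lambda>x. x * c)"
    using real_bounded_linear by blast
  then show ?case
    by (simp add: smooth_real_mult smooth_real_ident smooth_real_const)
qed (auto intro: smooth_real_const smooth_real_add smooth_real_mult)

text \<open>The classical smooth function that is flat at \<open>0\<close> is \<open>flat_exp 1\<close>; the polynomial factor makes the
  family closed under differentiation.\<close>

definition flat_exp :: "real poly \<Rightarrow> real \<Rightarrow> real" where
  "flat_exp p x = (if 0 < x then poly p (1 / x) * exp (- (1 / x)) else 0)"

lemma tendsto_poly_exp_minus: "((\<lambda>t. poly p t * exp (- t)) \<longlongrightarrow> 0) at_top" for p :: "real poly"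
proof -
  have "((\<lambda>t. \<Sum>i\<le>degree p. coeff p i * (t ^ i / exp t)) \<longlongrightarrow> (\<Sum>i\<le>degree p. coeff p i * 0)) at_top"
    by (intro tendsto_intros tendsto_power_div_exp_0)
  then show ?thesis
    by (simp add: poly_altdef sum_distrib_right exp_minus divide_inverse mult.assoc)
qed

text \<open>With t = 1/x, the derivative of p(t) exp(-t) with respect to x is t^2 (p(t) - p'(t))
  exp(-t), and \<open>[:0, 0, 1:]\<close> is the polynomial t^2. At the origin the difference
  quotient is examined from each side.\<close>

lemma flat_exp_has_deriv:
  "(flat_exp p has_real_derivative flat_exp ([:0, 0, 1:] * (p - pderiv p)) x) (at x)"
proof (cases x "0 :: real" rule: linorder_cases)
  case less
  have "((\<lambda>x. 0) has_real_derivative 0) (at x)" by simp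
  then have "(flat_exp p has_real_derivative 0) (at x)"
    by (rule has_field_derivative_transform_within_open[where S="{..<0}"])
      (use less in \<open>auto simp: flat_exp_def\<close>)
  with less show ?thesis by (simp add: flat_exp_def)
next
  case greater
  have "((\<lambda>x. poly p (1 / x) * exp (- (1 / x))) has_real_derivative
      flat_exp ([:0, 0, 1:] * (p - pderiv p)) x) (at x)"
    using greater
    by (auto intro!: derivative_eq_intros DERIV_chain2[OF poly_DERIV]
        simp: flat_exp_def power2_eq_square) (simp add: field_simps)
  then show ?thesis
    by (rule has_field_derivative_transform_within_open[where S="{0<..}"])
      (use greater in \<open>auto simp: flat_exp_def\<close>)
next
  case equal
  have "((\<lambda>h. flat_exp p h / h) \<longlongrightarrow> 0) (at_left 0)"
    by (rule tendsto_eventually)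
      (auto simp: flat_exp_def eventually_at_filter)
  moreover have "((\<lambda>h. flat_exp p h / h) \<longlongrightarrow> 0) (at_right 0)"
    unfolding filterlim_at_right_to_top
  \<comment> \<open>Dividing by h = 1/t multiplies the polynomial by t, which is the factor
    \<open>[:0, 1:]\<close>.\<close>
  proof (rule Lim_transform_eventually[OF tendsto_poly_exp_minus[of "[:0, 1:] * p"]])
    show "\<forall>\<^sub>F t in at_top. poly ([:0, 1:] * p) t * exp (- t) = flat_exp p (inverse t) / inverse t"
      using eventually_gt_at_top[of 0]
      by eventually_elim (auto simp: flat_exp_def field_simps)
  qed
  ultimately have "((\<lambda>h. flat_exp p h / h) \<longlongrightarrow> 0) (at 0)"
    by (rule filterlim_split_at)
  with equal show ?thesis
    by (simp add: DERIV_def flat_exp_def)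
qed

text \<open>The scalar \<open>c\<close> in the invariant set absorbs the chain rule factor
  \<open>a\<close>, so that the set is closed under \<open>deriv\<close>.\<close>

lemma smooth_real_flat_exp_affine: "smooth_real (\<lambda>x. flat_exp p (a * x + b))"
proof (rule smooth_real_coinduct[where C="range (\<lambda>(c, p) x. c * flat_exp p (a * x + b))"])
  have "(\<lambda>x. flat_exp p (a * x + b)) = (\<lambda>(c, p) x. c * flat_exp p (a * x + b)) (1, p)"
    by simp
  then show "(\<lambda>x. flat_exp p (a * x + b)) \<in> range (\<lambda>(c, p) x. c * flat_exp p (a * x + b))"
    by blast
next
  fix f
  assume "f \<in> range (\<lambda>(c, p) x. c * flat_exp p (a * x + b))"
  then obtain c p where f: "f = (\<lambda>x. c * flat_exp p (a * x + b))" by auto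
  define q where "q = [:0, 0, 1:] * (p - pderiv p)"
  have d: "(f has_real_derivative (c * a) * flat_exp q (a * x + b)) (at x)" for x
    unfolding f q_def
    by (rule derivative_eq_intros DERIV_chain2[OF flat_exp_has_deriv] refl | simp)+
  then have "deriv f = (\<lambda>x. (c * a) * flat_exp q (a * x + b))"
    by (intro ext DERIV_imp_deriv)
  also have "\<dots> = (\<lambda>(c, p) x. c * flat_exp p (a * x + b)) (c * a, q)"
    by simp
  finally have "deriv f \<in> range (\<lambda>(c, p) x. c * flat_exp p (a * x + b))"
    by blast
  then show "f differentiable_on UNIV \<and> deriv f \<in> range (\<lambda>(c, p) x. c * flat_exp p (a * x + b))"
    using d by (auto simp: differentiable_on_def real_differentiable_def)
qed

section \<open>Test functions and square integrable functions\<close>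

lemma flat_exp_one: "flat_exp 1 x = (if 0 < x then exp (- (1 / x)) else 0)"
  by (simp add: flat_exp_def)

text \<open>The interval may be empty, which forces \<phi> = 0; cutoffs with a small index can fall
  under this case.\<close>

lemma test_functionsI:
  assumes "smooth_real \<phi>" and "\<And>x. x \<notin> {a..b} \<Longrightarrow> \<phi> x = 0" and "{a..b} \<subseteq> S"
  shows "\<phi> \<in> test_functions S"
proof -
  have sub: "closure {x. \<phi> x \<noteq> 0} \<subseteq> {a..b}"
    using assms(2) by (intro closure_minimal) (metis (mono_tags) mem_Collect_eq subsetI, simp)
  then have "compact (closure {x. \<phi> x \<noteq> 0})"
    by (metis Int_absorb1 closed_closure compact_Icc compact_Int_closed)
  with sub assms(1,3) show ?thesis
    by (auto simp: test_functions_def smooth_real_def)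
qed

lemma test_functions_smooth: "\<phi> \<in> test_functions S \<Longrightarrow> smooth_real \<phi>"
  by (simp add: test_functions_def smooth_real_def)

lemma test_functions_add:
  assumes "\<phi> \<in> test_functions S" "\<psi> \<in> test_functions S"
  shows "(\<lambda>x. \<phi> x + \<psi> x) \<in> test_functions S"
proof -
  let ?K = "closure {x. \<phi> x \<noteq> 0} \<union> closure {x. \<psi> x \<noteq> 0}"
  have K: "compact ?K" "?K \<subseteq> S"
    using assms by (auto simp: test_functions_def)
  have "closure {x. \<phi> x + \<psi> x \<noteq> 0} \<subseteq> ?K"
  proof (rule closure_minimal)
    show "{x. \<phi> x + \<psi> x \<noteq> 0} \<subseteq> ?K"
      using closure_subset[of "{x. \<phi> x \<noteq> 0}"] closure_subset[of "{x. \<psi> x \<noteq> 0}"] by fastforce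
  qed (rule closed_Un[OF closed_closure closed_closure])
  moreover from this have "compact (closure {x. \<phi> x + \<psi> x \<noteq> 0})"
    using K(1) by (metis Int_absorb1 closed_closure compact_Int_closed)
  moreover have "smooth_real (\<lambda>x. \<phi> x + \<psi> x)"
    using assms by (simp add: smooth_real_add test_functions_smooth)
  ultimately show ?thesis
    using K(2) by (auto simp: test_functions_def smooth_real_def)
qed

lemma test_functions_cmult:
  assumes "\<phi> \<in> test_functions S"
  shows "(\<lambda>x. c * \<phi> x) \<in> test_functions S"
proof -
  have sub: "closure {x. c * \<phi> x \<noteq> 0} \<subseteq> closure {x. \<phi> x \<noteq> 0}"
    by (rule closure_mono) auto
  have K: "compact (closure {x. \<phi> x \<noteq> 0})" "closure {x. \<phi> x \<noteq> 0} \<subseteq> S"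
    using assms by (auto simp: test_functions_def)
  have "compact (closure {x. c * \<phi> x \<noteq> 0})"
    using K(1) sub by (metis Int_absorb1 closed_closure compact_Int_closed)
  moreover have "closure {x. c * \<phi> x \<noteq> 0} \<subseteq> S"
    using K sub by blast
  moreover have "smooth_real (\<lambda>x. c * \<phi> x)"
    using assms by (simp add: smooth_real_mult smooth_real_const test_functions_smooth)
  ultimately show ?thesis
    by (simp add: test_functions_def smooth_real_def)
qed

lemma test_functions_support:
  assumes "\<phi> \<in> test_functions {0<..<L}" "0 < L"
  obtains a b where "0 < a" "a \<le> b" "b < L" "\<And>x. x \<notin> {a..b} \<Longrightarrow> \<phi> x = 0"
proof -
  \<comment> \<open>The midpoint keeps the compact set nonempty even for \<phi> = 0, so that its
    minimum and maximum exist.\<close>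
  let ?K = "insert (L / 2) (closure {x. \<phi> x \<noteq> 0})"
  have K: "compact ?K" "?K \<subseteq> {0<..<L}"
    using assms by (auto simp: test_functions_def)
  obtain a where a: "a \<in> ?K" "\<And>y. y \<in> ?K \<Longrightarrow> a \<le> y"
    using compact_attains_inf[OF K(1)] by blast
  obtain b where b: "b \<in> ?K" "\<And>y. y \<in> ?K \<Longrightarrow> y \<le> b"
    using compact_attains_sup[OF K(1)] by blast
  have "\<phi> x = 0" if "x \<notin> {a..b}" for x
    using that a(2)[of x] b(2)[of x] closure_subset[of "{x. \<phi> x \<noteq> 0}"] by auto
  then show ?thesis
    using a(1,2) b(1) K(2) that[of a b] by (meson greaterThanLessThan_iff subsetD)
qed

section \<open>Norm and inner product in L2\<close>

definition L2norm :: "real set \<Rightarrow> (real \<Rightarrow> real) \<Rightarrow> real" where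
  "L2norm S f = sqrt (LINT x|lebesgue_on S. (f x)\<^sup>2)"

lemma L2norm_nonneg [simp]: "0 \<le> L2norm S f"
  by (simp add: L2norm_def)

lemma L2norm_square: "(L2norm S f)\<^sup>2 = (LINT x|lebesgue_on S. (f x)\<^sup>2)"
  by (simp add: L2norm_def)

lemma L2_measurable: "f \<in> L2 S \<Longrightarrow> f \<in> borel_measurable (lebesgue_on S)"
  and L2_square_integrable: "f \<in> L2 S \<Longrightarrow> integrable (lebesgue_on S) (\<lambda>x. (f x)\<^sup>2)"
  by (auto simp: L2_def)

lemma L2_mult_integrable:
  assumes "f \<in> L2 S" "g \<in> L2 S"
  shows "integrable (lebesgue_on S) (\<lambda>x. f x * g x)"
proof (rule Bochner_Integration.integrable_bound)
  show "integrable (lebesgue_on S) (\<lambda>x. (f x)\<^sup>2 + (g x)\<^sup>2)"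
    using assms by (intro Bochner_Integration.integrable_add L2_square_integrable)
  show "(\<lambda>x. f x * g x) \<in> borel_measurable (lebesgue_on S)"
    using L2_measurable[OF assms(1)] L2_measurable[OF assms(2)] by measurable
  have "\<bar>a * b\<bar> \<le> a\<^sup>2 + b\<^sup>2" for a b :: real
  proof -
    have "2 * \<bar>a * b\<bar> \<le> a\<^sup>2 + b\<^sup>2"
      using sum_squares_bound[of "\<bar>a\<bar>" "\<bar>b\<bar>"] by (simp add: abs_mult mult.assoc)
    then show ?thesis using abs_ge_zero[of "a * b"] by linarith
  qed
  then show "AE x in lebesgue_on S. norm (f x * g x) \<le> norm ((f x)\<^sup>2 + (g x)\<^sup>2)"
    by auto
qed

lemma L2_add:
  assumes "f \<in> L2 S" "g \<in> L2 S"
  shows "(\<lambda>x. f x + g x) \<in> L2 S"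
proof -
  have "integrable (lebesgue_on S) (\<lambda>x. (f x)\<^sup>2 + (g x)\<^sup>2 + 2 * (f x * g x))"
    using assms
    by (intro Bochner_Integration.integrable_add L2_square_integrable integrable_mult_right
        L2_mult_integrable)
  then show ?thesis
    using L2_measurable[OF assms(1)] L2_measurable[OF assms(2)]
    by (simp add: L2_def power2_sum mult.assoc)
qed

lemma L2_cmult: "f \<in> L2 S \<Longrightarrow> (\<lambda>x. c * f x) \<in> L2 S"
  by (auto simp: L2_def power_mult_distrib)

lemma L2_diff:
  assumes "f \<in> L2 S" "g \<in> L2 S"
  shows "(\<lambda>x. f x - g x) \<in> L2 S"
  using L2_add[OF assms(1) L2_cmult[OF assms(2), of "-1"]] by simp

lemma L2_bounded_mult:
  assumes "a \<in> borel_measurable (lebesgue_on S)" "\<And>x. x \<in> S \<Longrightarrow> \<bar>a x\<bar> \<le> B" "f \<in> L2 S"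
  shows "(\<lambda>x. a x * f x) \<in> L2 S" "L2norm S (\<lambda>x. a x * f x) \<le> B * L2norm S f"
proof -
  have le: "(a x * f x)\<^sup>2 \<le> B\<^sup>2 * (f x)\<^sup>2" if "x \<in> S" for x
  proof -
    have "(a x)\<^sup>2 \<le> B\<^sup>2"
      using assms(2)[OF that] by (rule abs_le_square_iff[THEN iffD1, OF order_trans]) auto
    then show ?thesis
      by (simp add: power_mult_distrib mult_right_mono)
  qed
  have int: "integrable (lebesgue_on S) (\<lambda>x. B\<^sup>2 * (f x)\<^sup>2)"
    by (intro integrable_mult_right L2_square_integrable assms)
  have int': "integrable (lebesgue_on S) (\<lambda>x. (a x * f x)\<^sup>2)"
    using assms(1) L2_measurable[OF assms(3)] le
    by (intro Bochner_Integration.integrable_bound[OF int] AE_I2) auto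
  then show "(\<lambda>x. a x * f x) \<in> L2 S"
    using assms(1) L2_measurable[OF assms(3)] by (auto simp: L2_def)
  have "(LINT x|lebesgue_on S. (a x * f x)\<^sup>2) \<le> (LINT x|lebesgue_on S. B\<^sup>2 * (f x)\<^sup>2)"
    by (rule integral_mono[OF int' int]) (use le in auto)
  then have "(L2norm S (\<lambda>x. a x * f x))\<^sup>2 \<le> (\<bar>B\<bar> * L2norm S f)\<^sup>2"
    by (simp add: L2norm_square power_mult_distrib)
  then have le2: "L2norm S (\<lambda>x. a x * f x) \<le> \<bar>B\<bar> * L2norm S f"
    by (rule power2_le_imp_le) simp
  show "L2norm S (\<lambda>x. a x * f x) \<le> B * L2norm S f"
  \<comment> \<open>\<open>B\<close> may be negative when \<open>S\<close> is empty; both norms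
    vanish then.\<close>
  proof (cases "S = {}")
    case False
    then have "0 \<le> B" using assms(2) by fastforce
    with le2 show ?thesis by simp
  qed (simp add: L2norm_def)
qed

text \<open>The quadratic form in (s, t) is nonnegative. Keeping both parameters allows the
  substitution s = b, t = -c, which gives b (a b - c^2) without a division.\<close>

lemma L2_Cauchy_Schwarz:
  assumes "f \<in> L2 S" "g \<in> L2 S"
  shows "\<bar>LINT x|lebesgue_on S. f x * g x\<bar> \<le> L2norm S f * L2norm S g"
proof -
  define a b c where "a = (LINT x|lebesgue_on S. (f x)\<^sup>2)"
    and "b = (LINT x|lebesgue_on S. (g x)\<^sup>2)" and "c = (LINT x|lebesgue_on S. f x * g x)"
  have quad: "0 \<le> s\<^sup>2 * a + 2 * s * t * c + t\<^sup>2 * b" for s t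
  proof -
    have "0 \<le> (LINT x|lebesgue_on S. (s * f x + t * g x)\<^sup>2)"
      by (rule integral_nonneg_AE) simp
    also have "\<dots> = (LINT x|lebesgue_on S. s\<^sup>2 * (f x)\<^sup>2 + 2 * s * t * (f x * g x) + t\<^sup>2 * (g x)\<^sup>2)"
      by (rule Bochner_Integration.integral_cong) (auto simp: power2_eq_square algebra_simps)
    also have "\<dots> = s\<^sup>2 * a + 2 * s * t * c + t\<^sup>2 * b"
      unfolding a_def b_def c_def
      using assms by (simp add: L2_mult_integrable L2_square_integrable)
    finally show ?thesis .
  qed
  have ab: "0 \<le> a" "0 \<le> b" by (simp_all add: a_def b_def)
  have "c\<^sup>2 \<le> a * b"
  proof (cases "b = 0")
    case True
    have "c = 0"
    proof (rule ccontr)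
      assume "c \<noteq> 0"
      then show False
        \<comment> \<open>For b = 0 this choice of t turns the form into a - (a + 1) = -1.\<close>
        using quad[of 1 "- (a + 1) / (2 * c)"] True ab by (simp add: field_simps)
    qed
    then show ?thesis using ab by simp
  next
    case False
    with ab have "0 < b" by simp
    have "0 \<le> b * (a * b - c\<^sup>2)"
      using quad[of b "-c"] by (simp add: power2_eq_square algebra_simps)
    with \<open>0 < b\<close> show ?thesis by (simp add: zero_le_mult_iff)
  qed
  then have "c\<^sup>2 \<le> (L2norm S f * L2norm S g)\<^sup>2"
    by (simp add: power_mult_distrib L2norm_square a_def b_def)
  then show ?thesis
    unfolding c_def by (metis abs_le_square_iff abs_of_nonneg L2norm_nonneg mult_nonneg_nonneg)
qed

lemma L2norm_triangle:
  assumes "f \<in> L2 S" "g \<in> L2 S"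
  shows "L2norm S (\<lambda>x. f x + g x) \<le> L2norm S f + L2norm S g"
proof (rule power2_le_imp_le)
  have "(L2norm S (\<lambda>x. f x + g x))\<^sup>2 = (LINT x|lebesgue_on S. (f x)\<^sup>2 + (g x)\<^sup>2 + 2 * (f x * g x))"
    by (simp add: L2norm_square power2_sum mult.assoc)
  also have "\<dots> = (L2norm S f)\<^sup>2 + (L2norm S g)\<^sup>2 + 2 * (LINT x|lebesgue_on S. f x * g x)"
    using assms by (simp add: L2norm_square L2_mult_integrable L2_square_integrable)
  also have "\<dots> \<le> (L2norm S f + L2norm S g)\<^sup>2"
    using L2_Cauchy_Schwarz[OF assms] by (simp add: power2_sum)
  finally show "(L2norm S (\<lambda>x. f x + g x))\<^sup>2 \<le> (L2norm S f + L2norm S g)\<^sup>2" .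
qed simp

lemma L2norm_cmult: "L2norm S (\<lambda>x. c * f x) = \<bar>c\<bar> * L2norm S f"
  by (simp add: L2norm_def power_mult_distrib real_sqrt_mult)

lemma L2norm_triangle_diff:
  assumes "f \<in> L2 S" "g \<in> L2 S"
  shows "L2norm S (\<lambda>x. f x - g x) \<le> L2norm S f + L2norm S g"
  using L2norm_triangle[OF assms(1) L2_cmult[OF assms(2), of "-1"]] L2norm_cmult[of S "-1" g]
  by simp

lemma L2norm_cong_AE:
  assumes "f \<in> borel_measurable (lebesgue_on S)" "g \<in> borel_measurable (lebesgue_on S)"
    and "AE x in lebesgue_on S. f x = g x"
  shows "L2norm S f = L2norm S g"
proof -
  have "AE x in lebesgue_on S. (f x)\<^sup>2 = (g x)\<^sup>2"
    using assms(3) by eventually_elim simp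
  then show ?thesis
    unfolding L2norm_def using assms(1,2) by (auto intro!: integral_cong_AE)
qed

lemma L2norm_eq_0_AE:
  assumes "f \<in> L2 S" "L2norm S f = 0"
  shows "AE x in lebesgue_on S. f x = 0"
  using assms integral_nonneg_eq_0_iff_AE[OF L2_square_integrable[OF assms(1)]]
  by (simp add: L2norm_def)

section \<open>Approximation of bounded measurable functions by test functions\<close>

lemma continuous_on_measurable_lebesgue_on:
  "continuous_on UNIV f \<Longrightarrow> (f :: real \<Rightarrow> real) \<in> borel_measurable (lebesgue_on S)"
  by (simp add: borel_measurable_continuous_onI measurable_completion measurable_restrict_space1)

lemma smooth_real_continuous: "smooth_real f \<Longrightarrow> continuous_on UNIV f"
  by (auto intro!: continuous_at_imp_continuous_on DERIV_isCont[OF smooth_real_has_deriv])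

text \<open>As \<open>n\<close> grows, both factors \<open>exp (- 1 / (n x - 1))\<close> and \<open>exp (- 1 / (n (L - x) - 1))\<close> tend to \<open>1\<close>
  inside the interval, so no plateau construction is needed.\<close>

definition cutoff :: "real \<Rightarrow> nat \<Rightarrow> real \<Rightarrow> real" where
  "cutoff L n x = flat_exp 1 (real n * x + (- 1)) * flat_exp 1 ((- real n) * x + (real n * L - 1))"

lemma cutoff_smooth: "smooth_real (cutoff L n)"
  unfolding cutoff_def[abs_def] by (intro smooth_real_mult smooth_real_flat_exp_affine)

lemma cutoff_range: "0 \<le> cutoff L n x" "cutoff L n x \<le> 1"
proof -
  have *: "0 \<le> flat_exp 1 y \<and> flat_exp 1 y \<le> 1" for y by (simp add: flat_exp_one)
  show "0 \<le> cutoff L n x" "cutoff L n x \<le> 1"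
    unfolding cutoff_def using * by (simp, intro mult_le_one) auto
qed

lemma cutoff_zero:
  assumes "x \<notin> {1 / real n..L - 1 / real n}"
  shows "cutoff L n x = 0"
\<comment> \<open>For n = 0 the convention 1 / 0 = 0 makes the interval {0..L}; the cutoff vanishes
  because both arguments of \<open>flat_exp\<close> are -1.\<close>
proof (cases "n = 0")
  case False
  then have "real n * x + (- 1) \<le> 0 \<or> (- real n) * x + (real n * L - 1) \<le> 0"
    using assms by (auto simp: field_simps not_le)
  then show ?thesis by (auto simp: cutoff_def flat_exp_one)
qed (simp add: cutoff_def flat_exp_one)

lemma cutoff_tendsto:
  assumes "0 < x" "x < L"
  shows "(\<lambda>n. cutoff L n x) \<longlonglongrightarrow> 1"
proof -
  have *: "(\<lambda>n. flat_exp 1 (c * real n - 1)) \<longlonglongrightarrow> 1" if "0 < c" for c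
  proof -
    have top: "filterlim (\<lambda>n. c * real n - 1) at_top sequentially"
      using that by real_asymp
    have "(\<lambda>n. exp (- (1 / (c * real n - 1)))) \<longlonglongrightarrow> 1"
      using that by real_asymp
    moreover have "\<forall>\<^sub>F n in sequentially. exp (- (1 / (c * real n - 1))) = flat_exp 1 (c * real n - 1)"
      using filterlim_at_top_dense[THEN iffD1, OF top, rule_format, of 0]
      by eventually_elim (simp add: flat_exp_one)
    ultimately show ?thesis by (rule Lim_transform_eventually)
  qed
  have "(\<lambda>n. flat_exp 1 (x * real n - 1) * flat_exp 1 ((L - x) * real n - 1)) \<longlonglongrightarrow> 1 * 1"
    using assms by (intro tendsto_mult *) auto
  then show ?thesis
    by (simp add: cutoff_def[abs_def] algebra_simps)
qed

text \<open>A measurable function is an almost everywhere limit of continuous functions. Clamping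
  them to [-B, B] bounds them without changing the limit, Stone-Weierstrass makes them polynomial up
  to an error 1/(n+1) on [0, L], and the cutoff gives compact support. The error is at most 1, hence
  the bound B + 1; its uniformity in n serves dominated convergence.\<close>

lemma bounded_approx_test_functions:
  assumes g: "g \<in> borel_measurable (lebesgue_on {0<..<L})" and B: "\<And>x. x \<in> {0<..<L} \<Longrightarrow> \<bar>g x\<bar> \<le> B"
    and "0 < L"
  obtains \<psi> where "\<And>n. \<psi> n \<in> test_functions {0<..<L}"
    and "\<And>n x. x \<in> {0<..<L} \<Longrightarrow> \<bar>\<psi> n x\<bar> \<le> B + 1"
    and "AE x in lebesgue_on {0<..<L}. (\<lambda>n. \<psi> n x) \<longlonglongrightarrow> g x"
proof -
  let ?S = "{0<..<L}"
  have "g measurable_on ?S"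
    using g by (simp add: measurable_on_iff_borel_measurable)
  then obtain N G where N: "negligible N" and G: "\<And>n. continuous_on UNIV (G n)"
    and lim: "\<And>x. x \<notin> N \<Longrightarrow> (\<lambda>n. G n x) \<longlonglongrightarrow> (if x \<in> ?S then g x else 0)"
    unfolding measurable_on_def by blast
  define C where "C n x = max (- B) (min B (G n x))" for n x
  have "continuous_on {0..L} (C n)" for n
    unfolding C_def by (intro continuous_intros continuous_on_subset[OF G]) auto
  then have "\<exists>p. real_polynomial_function p \<and> (\<forall>x\<in>{0..L}. \<bar>C n x - p x\<bar> < inverse (real (Suc n)))" for n
    using Stone_Weierstrass_real_polynomial_function[of "{0..L}" "C n" "inverse (real (Suc n))"]
    by (metis compact_Icc inverse_positive_iff_positive of_nat_0_less_iff zero_less_Suc)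
  then obtain p where p: "\<And>n. real_polynomial_function (p n)"
    and near: "\<And>n x. x \<in> {0..L} \<Longrightarrow> \<bar>C n x - p n x\<bar> < inverse (real (Suc n))"
    by metis
  have B0: "0 \<le> B"
    using B[of "L / 2"] \<open>0 < L\<close> by auto
  define \<psi> where "\<psi> n x = cutoff L n x * p n x" for n x
  show ?thesis
  proof
    show "\<psi> n \<in> test_functions ?S" for n
    \<comment> \<open>With 1 / 0 = 0 the supporting interval would be {0..L}, which is not inside
      the open set; but the cutoff with index 0 is identically zero.\<close>
    proof (cases "n = 0")
      case True
      then have "\<psi> n = (\<lambda>x. 0)" by (simp add: \<psi>_def[abs_def] cutoff_def flat_exp_one)
      then show ?thesis
        \<comment> \<open>The endpoints 1 and 0 describe an empty interval.\<close>
        using test_functionsI[OF smooth_real_const, of 1 0 0 ?S] by simp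
    next
      case False
      show ?thesis
      proof (rule test_functionsI[where a = "1 / real n" and b = "L - 1 / real n"])
        show "smooth_real (\<psi> n)"
          unfolding \<psi>_def by (intro smooth_real_mult cutoff_smooth smooth_real_polynomial_function p)
        show "{1 / real n..L - 1 / real n} \<subseteq> ?S"
        proof -
          have "0 < 1 / real n" using False by simp
          then show ?thesis by (auto simp del: zero_less_divide_1_iff)
        qed
      qed (simp add: \<psi>_def cutoff_zero)
    qed
    show "\<bar>\<psi> n x\<bar> \<le> B + 1" if "x \<in> ?S" for n x
    proof -
      have "\<bar>p n x\<bar> \<le> B + 1"
      proof -
        have "\<bar>C n x\<bar> \<le> B" using B0 by (auto simp: C_def)
        moreover have "\<bar>C n x - p n x\<bar> < inverse (real (Suc n))" using near that by auto
        moreover have "inverse (real (Suc n)) \<le> 1" by (simp add: inverse_le_1_iff)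
        ultimately show ?thesis by linarith
      qed
      then have "cutoff L n x * \<bar>p n x\<bar> \<le> 1 * (B + 1)"
        using cutoff_range B0 by (intro mult_mono) auto
      then show ?thesis
        using cutoff_range(1)[of L n x] by (simp add: \<psi>_def abs_mult)
    qed
    have conv: "(\<lambda>n. \<psi> n x) \<longlonglongrightarrow> g x" if x: "x \<in> ?S" "x \<notin> N" for x
    proof -
      have "(\<lambda>n. G n x) \<longlonglongrightarrow> g x" using lim[OF x(2)] x(1) by simp
      then have "(\<lambda>n. C n x) \<longlonglongrightarrow> max (- B) (min B (g x))"
        unfolding C_def by (intro tendsto_intros)
      also have "max (- B) (min B (g x)) = g x"
        using B[OF x(1)] by auto
      finally have C: "(\<lambda>n. C n x) \<longlonglongrightarrow> g x" .
      have "(\<lambda>n. C n x - p n x) \<longlonglongrightarrow> 0"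
        using near x(1)
        by (intro Lim_null_comparison[OF _ LIMSEQ_inverse_real_of_nat] always_eventually allI)
          (simp add: less_imp_le)
      from tendsto_diff[OF C this] have "(\<lambda>n. p n x) \<longlonglongrightarrow> g x" by simp
      from tendsto_mult[OF cutoff_tendsto this] x(1) show ?thesis by (simp add: \<psi>_def)
    qed
    have "AE x in lebesgue. x \<notin> N"
      using N by (simp add: negligible_iff_null_sets AE_not_in)
    then show "AE x in lebesgue_on ?S. (\<lambda>n. \<psi> n x) \<longlonglongrightarrow> g x"
      by (subst AE_restrict_space_iff) (auto elim!: eventually_mono intro: conv)
  qed
qed

section \<open>Primitives of square integrable functions\<close>

locale interval =
  fixes L :: real
  assumes L_pos: "0 < L"
begin

abbreviation Om :: "real set" where "Om \<equiv> {0<..<L}"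
abbreviation M :: "real measure" where "M \<equiv> lebesgue_on {0<..<L}"

sublocale finite_measure M
  by (rule finite_measure_lebesgue_on) simp

lemma bounded_L2:
  assumes "f \<in> borel_measurable M" "\<And>x. x \<in> Om \<Longrightarrow> \<bar>f x\<bar> \<le> B"
  shows "f \<in> L2 Om"
proof -
  have "(\<lambda>x. 1) \<in> L2 Om" by (simp add: L2_def)
  from L2_bounded_mult(1)[OF assms this] show ?thesis by simp
qed

lemma measure_M: "A \<in> sets lebesgue \<Longrightarrow> A \<subseteq> Om \<Longrightarrow> measure M A = measure lebesgue A"
  by (simp add: measure_restrict_space)

lemma bounded_L2norm_le:
  assumes "f \<in> borel_measurable M" "\<And>x. x \<in> Om \<Longrightarrow> \<bar>f x\<bar> \<le> B"
  shows "L2norm Om f \<le> B * sqrt L"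
proof -
  have "(\<lambda>x. 1) \<in> L2 Om" by (simp add: L2_def)
  from L2_bounded_mult(2)[OF assms this] show ?thesis
    using L_pos by (simp add: L2norm_def measure_M)
qed

lemma L2_integrable: "f \<in> L2 Om \<Longrightarrow> integrable M f"
  using L2_mult_integrable[of f Om "\<lambda>x. 1"] by (simp add: L2_def)

lemma deriv_test_functions:
  assumes "\<phi> \<in> test_functions Om"
  shows "deriv \<phi> \<in> test_functions Om"
proof -
  obtain a b where ab: "0 < a" "a \<le> b" "b < L" "\<And>x. x \<notin> {a..b} \<Longrightarrow> \<phi> x = 0"
    using test_functions_support[OF assms L_pos] by blast
  have "deriv \<phi> x = 0" if "x \<notin> {a..b}" for x
  proof (rule DERIV_imp_deriv)
    have "((\<lambda>x. 0) has_real_derivative 0) (at x)" by simp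
    then show "(\<phi> has_real_derivative 0) (at x)"
      by (rule has_field_derivative_transform_within_open[where S="- {a..b}"])
        (use that ab(4) in auto)
  qed
  then show ?thesis
    using ab smooth_real_deriv[OF test_functions_smooth[OF assms]]
    by (intro test_functionsI[where a=a and b=b]) auto
qed

lemma test_functions_L2:
  assumes "\<phi> \<in> test_functions Om"
  shows "\<phi> \<in> L2 Om"
proof -
  have cont: "continuous_on UNIV \<phi>"
    using assms by (intro smooth_real_continuous test_functions_smooth)
  then have "compact (\<phi> ` {0..L})"
    by (intro compact_continuous_image continuous_on_subset[OF cont]) auto
  then have "\<exists>B. \<forall>x\<in>{0..L}. \<bar>\<phi> x\<bar> \<le> B"
    using compact_imp_bounded[of "\<phi> ` {0..L}"] by (auto simp: bounded_real)
  then obtain B where "\<And>x. x \<in> {0..L} \<Longrightarrow> \<bar>\<phi> x\<bar> \<le> B"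
    by blast
  then show ?thesis
    by (intro bounded_L2[of _ B] continuous_on_measurable_lebesgue_on cont) auto
qed

text \<open>This is the integral of g from 0 to x. The indicator in the integrand makes it a total
  function, constant on either side of the interval, and presents it as an inner product, the form
  suited to Cauchy-Schwarz and Fubini.\<close>

definition prim :: "(real \<Rightarrow> real) \<Rightarrow> real \<Rightarrow> real" where
  "prim g x = (LINT t|M. indicator {..x} t * g t)"

lemma indicator_L2: "A \<in> sets borel \<Longrightarrow> indicator A \<in> L2 Om"
proof (rule bounded_L2[of _ 1])
  assume "A \<in> sets borel"
  then show "indicator A \<in> borel_measurable M"
    by (intro measurable_restrict_space1 measurable_completion) simp
qed (auto simp: indicator_def)

lemma indicator_mult_L2:
  assumes "A \<in> sets borel" "g \<in> L2 Om"
  shows "(\<lambda>t. indicator A t * g t) \<in> L2 Om"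
  using L2_bounded_mult(1)[OF L2_measurable[OF indicator_L2[OF assms(1)]], of 1 g] assms(2)
  by (auto simp: indicator_def)

lemma prim_diff:
  assumes "f \<in> L2 Om" "g \<in> L2 Om"
  shows "prim (\<lambda>x. f x - g x) x = prim f x - prim g x"
  unfolding prim_def using assms
  by (simp add: right_diff_distrib L2_integrable indicator_mult_L2)

text \<open>Cauchy-Schwarz against the indicator of the interval between the two points, whose norm
  is at most the root of its length. The modulus depends on g through its norm only, so bounded
  families have equicontinuous primitives.\<close>

lemma prim_holder:
  assumes "g \<in> L2 Om"
  shows "\<bar>prim g x - prim g y\<bar> \<le> sqrt \<bar>x - y\<bar> * L2norm Om g"
proof -
  have *: "\<bar>prim g x - prim g y\<bar> \<le> sqrt (x - y) * L2norm Om g" if "y \<le> x" for x y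
  proof -
    have "prim g x - prim g y = (LINT t|M. indicator {..x} t * g t - indicator {..y} t * g t)"
      unfolding prim_def using assms by (simp add: L2_integrable indicator_mult_L2)
    also have "\<dots> = (LINT t|M. indicator {y<..x} t * g t)"
      by (rule Bochner_Integration.integral_cong) (use that in \<open>auto simp: indicator_def\<close>)
    finally have "\<bar>prim g x - prim g y\<bar> \<le> L2norm Om (indicator {y<..x}) * L2norm Om g"
      using L2_Cauchy_Schwarz[OF indicator_L2 assms] by simp
    moreover have "L2norm Om (indicator {y<..x}) \<le> sqrt (x - y)"
    proof -
      have "(\<lambda>t. (indicat_real {y<..x} t)\<^sup>2) = indicator {y<..x}"
        by (auto simp: indicator_def)
      then have "(LINT t|M. (indicat_real {y<..x} t)\<^sup>2) = measure M ({y<..x} \<inter> Om)"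
        by simp
      also have "\<dots> = measure lebesgue ({y<..x} \<inter> Om)"
        by (intro measure_M) auto
      also have "\<dots> \<le> measure lebesgue {y<..x}"
        by (intro measure_mono_fmeasurable bounded_set_imp_lmeasurable) auto
      also have "\<dots> = x - y" using that by simp
      finally show ?thesis by (simp add: L2norm_def)
    qed
    ultimately show ?thesis
      by (meson L2norm_nonneg mult_right_mono order_trans)
  qed
  show ?thesis
    using *[of x y] *[of y x] by (cases "y \<le> x") (auto simp: abs_minus_commute)
qed

lemma prim_nonpos: "x \<le> 0 \<Longrightarrow> prim g x = 0"
  unfolding prim_def by (rule integral_eq_zero_AE) (auto simp: indicator_def intro!: AE_I2)

lemma prim_ge: "L \<le> x \<Longrightarrow> prim g x = (LINT t|M. g t)"
  unfolding prim_def by (rule Bochner_Integration.integral_cong) (auto simp: indicator_def)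

lemma prim_bound:
  assumes "g \<in> L2 Om" "x \<in> Om"
  shows "\<bar>prim g x\<bar> \<le> sqrt L * L2norm Om g"
proof -
  have "\<bar>prim g x\<bar> \<le> sqrt \<bar>x\<bar> * L2norm Om g"
    using prim_holder[OF assms(1), of x 0] by (simp add: prim_nonpos)
  also have "\<dots> \<le> sqrt L * L2norm Om g"
    using assms(2) by (intro mult_right_mono) auto
  finally show ?thesis .
qed

lemma prim_continuous:
  assumes "g \<in> L2 Om"
  shows "continuous_on UNIV (prim g)"
proof (clarsimp simp: continuous_on_eq_continuous_at isCont_def)
  fix x
  show "(prim g \<longlongrightarrow> prim g x) (at x)"
  proof (rule Lim_transform_bound[THEN LIM_zero_cancel, rotated])
    have "((\<lambda>y. sqrt \<bar>y - x\<bar> * L2norm Om g) \<longlongrightarrow> sqrt \<bar>x - x\<bar> * L2norm Om g) (at x)"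
      by (intro tendsto_intros)
    then show "((\<lambda>y. sqrt \<bar>y - x\<bar> * L2norm Om g) \<longlongrightarrow> 0) (at x)" by simp
    show "\<forall>\<^sub>F y in at x. norm (prim g y - prim g x) \<le> norm (sqrt \<bar>y - x\<bar> * L2norm Om g)"
      using prim_holder[OF assms] by (intro always_eventually allI) (simp add: abs_mult)
  qed
qed

lemma prim_measurable: "g \<in> L2 Om \<Longrightarrow> prim g \<in> borel_measurable M"
  by (intro continuous_on_measurable_lebesgue_on prim_continuous)

lemma prim_L2: "g \<in> L2 Om \<Longrightarrow> prim g \<in> L2 Om"
  by (rule bounded_L2[OF prim_measurable prim_bound])

text \<open>Poincare inequality for functions vanishing at 0: one factor sqrt L comes from the
  pointwise bound, the other from the length of the interval.\<close>

lemma prim_L2norm_le: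
  assumes "g \<in> L2 Om"
  shows "L2norm Om (prim g) \<le> L * L2norm Om g"
proof -
  have "L2norm Om (prim g) \<le> (sqrt L * L2norm Om g) * sqrt L"
    using assms by (intro bounded_L2norm_le prim_measurable prim_bound)
  then show ?thesis
    using L_pos by (simp add: mult.assoc mult.commute[of "L2norm Om g"] flip: real_sqrt_mult)
      (simp add: mult.assoc[symmetric])
qed

text \<open>Passes from the open interval with the completed measure to the closed one with the
  Borel measure, where the fundamental theorem applies; the endpoints form a null set.\<close>

lemma prim_FTC:
  assumes deriv: "\<And>x. (F has_real_derivative f x) (at x)" and cont: "continuous_on UNIV f"
    and x: "0 \<le> x" "x \<le> L"
  shows "prim f x = F x - F 0"
proof -
  have meas: "(\<lambda>t. f t * indicator {0..x} t) \<in> borel_measurable lborel"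
    using borel_measurable_continuous_onI[OF cont] by measurable
  have "prim f x = (LINT t|lebesgue. indicator Om t * (indicator {..x} t * f t))"
    unfolding prim_def by (subst integral_restrict_space) auto
  also have "\<dots> = (LINT t|lebesgue. f t * indicator {0..x} t)"
  proof (rule integral_cong_AE)
    have "AE t in lebesgue. t \<notin> {0, L}"
      by (rule AE_not_in) (simp add: negligible_iff_null_sets[symmetric])
    then show "AE t in lebesgue. indicator Om t * (indicator {..x} t * f t) = f t * indicator {0..x} t"
      by eventually_elim (use x in \<open>auto simp: indicator_def\<close>)
    show "(\<lambda>t. indicat_real Om t * (indicator {..x} t * f t)) \<in> borel_measurable lebesgue"
      using borel_measurable_continuous_onI[OF cont] by (intro measurable_completion) measurable
    show "(\<lambda>t. f t * indicator {0..x} t) \<in> borel_measurable lebesgue"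
      using meas by (intro measurable_completion)
  qed
  also have "\<dots> = (LINT t|lborel. f t * indicator {0..x} t)"
    using meas by (rule integral_completion)
  also have "\<dots> = F x - F 0"
    by (rule integral_FTC_Icc_real) (use x deriv cont in \<open>auto simp: continuous_on_eq_continuous_at\<close>)
  finally show ?thesis .
qed

lemma prim_deriv_test_functions:
  assumes "\<phi> \<in> test_functions Om" "x \<in> Om"
  shows "prim (deriv \<phi>) x = \<phi> x"
proof -
  obtain a b where "0 < a" "\<And>x. x \<notin> {a..b} \<Longrightarrow> \<phi> x = 0"
    using test_functions_support[OF assms(1) L_pos] by blast
  then have "\<phi> 0 = 0" by auto
  moreover have "smooth_real \<phi>" using assms(1) by (rule test_functions_smooth)
  then have "prim (deriv \<phi>) x = \<phi> x - \<phi> 0"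
    using assms(2)
    by (intro prim_FTC smooth_real_has_deriv smooth_real_continuous smooth_real_deriv) auto
  ultimately show ?thesis by simp
qed

lemma integral_deriv_test_functions:
  assumes "\<phi> \<in> test_functions Om"
  shows "(LINT x|M. deriv \<phi> x) = 0"
proof -
  obtain a b where "0 < a" "b < L" "\<And>x. x \<notin> {a..b} \<Longrightarrow> \<phi> x = 0"
    using test_functions_support[OF assms L_pos] by blast
  then have "\<phi> 0 = 0" "\<phi> L = 0" by auto
  moreover have "smooth_real \<phi>" using assms by (rule test_functions_smooth)
  then have "prim (deriv \<phi>) L = \<phi> L - \<phi> 0"
    using L_pos
    by (intro prim_FTC smooth_real_has_deriv smooth_real_continuous smooth_real_deriv) auto
  ultimately show ?thesis by (simp add: prim_ge)
qed

text \<open>Integration by parts, obtained by exchanging the order of integration over the triangle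
  t \<le> x. The inner integral of g over (t, L) is the negative of \<open>prim g t\<close> because
  g has mean zero, so no boundary term appears.\<close>

lemma integral_prim_mult:
  assumes f: "f \<in> L2 Om" and g: "g \<in> L2 Om" and g0: "(LINT x|M. g x) = 0"
  shows "(LINT x|M. prim f x * g x) = - (LINT t|M. f t * prim g t)"
proof -
  interpret P: pair_sigma_finite M M
    by (intro pair_sigma_finite.intro sigma_finite_measure_axioms)
  let ?h = "\<lambda>t x. indicator {..x} t * f t * g x"
  have id: "(\<lambda>p. fst p) \<in> borel_measurable (M \<Otimes>\<^sub>M M)" "(\<lambda>p. snd p) \<in> borel_measurable (M \<Otimes>\<^sub>M M)"
    using measurable_compose[OF measurable_fst id_borel_measurable_lebesgue_on]
      measurable_compose[OF measurable_snd id_borel_measurable_lebesgue_on] by (simp_all add: id_def)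
  have fg: "(\<lambda>p. f (fst p)) \<in> borel_measurable (M \<Otimes>\<^sub>M M)" "(\<lambda>p. g (snd p)) \<in> borel_measurable (M \<Otimes>\<^sub>M M)"
    using measurable_compose[OF measurable_fst L2_measurable[OF f]]
      measurable_compose[OF measurable_snd L2_measurable[OF g]] by auto
  have "(\<lambda>p. (if fst p \<le> snd p then 1 else 0) * f (fst p) * g (snd p)) \<in> borel_measurable (M \<Otimes>\<^sub>M M)"
    using id fg by measurable
  also have "(\<lambda>p. (if fst p \<le> snd p then 1 else 0) * f (fst p) * g (snd p)) = case_prod ?h"
    by (auto simp: indicator_def)
  finally have meas: "case_prod ?h \<in> borel_measurable (M \<Otimes>\<^sub>M M)" .
  have int2: "integrable M (\<lambda>x. ?h t x)" for t
  proof -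
    have "integrable M (\<lambda>x. f t * (indicator {t..} x * g x))"
      by (intro integrable_mult_right L2_integrable indicator_mult_L2 g) auto
    then show ?thesis
      by (rule Bochner_Integration.integrable_cong[THEN iffD1, rotated -1]) (auto simp: indicator_def)
  qed
  have "integrable (M \<Otimes>\<^sub>M M) (case_prod ?h)"
  proof (rule P.Fubini_integrable[OF meas])
    have "integrable M (\<lambda>t. \<bar>f t\<bar> * (LINT x|M. \<bar>g x\<bar>))"
      by (intro integrable_mult_left integrable_abs L2_integrable f)
    then show "integrable M (\<lambda>t. LINT x|M. norm (case_prod ?h (t, x)))"
    proof (rule Bochner_Integration.integrable_bound)
      show "(\<lambda>t. LINT x|M. norm (case_prod ?h (t, x))) \<in> borel_measurable M"
        using meas by measurable
      show "AE t in M. norm (LINT x|M. norm (case_prod ?h (t, x))) \<le> norm (\<bar>f t\<bar> * (LINT x|M. \<bar>g x\<bar>))"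
      proof (rule AE_I2)
        fix t
        have "(LINT x|M. norm (?h t x)) \<le> (LINT x|M. \<bar>f t\<bar> * \<bar>g x\<bar>)"
          by (intro integral_mono integrable_norm int2 integrable_mult_right integrable_abs L2_integrable g)
            (auto simp: indicator_def abs_mult)
        then show "norm (LINT x|M. norm (case_prod ?h (t, x))) \<le> norm (\<bar>f t\<bar> * (LINT x|M. \<bar>g x\<bar>))"
          by (simp add: abs_mult)
      qed
    qed
    show "AE t in M. integrable M (\<lambda>x. case_prod ?h (t, x))"
      using int2 by simp
  qed
  then have "(LINT x|M. LINT t|M. ?h t x) = (LINT t|M. LINT x|M. ?h t x)"
    by (rule P.Fubini_integral)
  moreover have "(LINT t|M. ?h t x) = prim f x * g x" for x
    by (simp add: prim_def)
  moreover have "(LINT x|M. ?h t x) = - (f t * prim g t)" for t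
  proof -
    have "(LINT x|M. indicator {..x} t * g x) = (LINT x|M. g x - indicator {..t} x * g x)"
    proof (rule integral_cong_AE)
      \<comment> \<open>The two integrands can disagree only at x = t.\<close>
      have "AE x in lebesgue. x \<notin> {t}"
        by (rule AE_not_in) (simp add: negligible_iff_null_sets[symmetric])
      then have "AE x in M. x \<notin> {t}"
        by (subst AE_restrict_space_iff) (auto elim: eventually_mono)
      then show "AE x in M. indicator {..x} t * g x = g x - indicator {..t} x * g x"
        by eventually_elim (auto simp: indicator_def)
      show "(\<lambda>x. g x - indicator {..t} x * g x) \<in> borel_measurable M"
        by (intro borel_measurable_diff L2_measurable indicator_mult_L2 g) auto
      have "(\<lambda>x. indicator {t..} x * g x) \<in> borel_measurable M"
        by (intro L2_measurable indicator_mult_L2 g) auto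
      then show "(\<lambda>x. indicator {..x} t * g x) \<in> borel_measurable M"
        by (rule measurable_cong[THEN iffD1, rotated -1]) (auto simp: indicator_def)
    qed
    also have "\<dots> = - prim g t"
      using g0 g by (simp add: prim_def L2_integrable indicator_mult_L2)
    finally show ?thesis
      by (simp add: mult.assoc mult.left_commute[of "indicator _ _"])
  qed
  ultimately show ?thesis by (simp add: prim_def[of f])
qed

end

section \<open>The Sobolev spaces\<close>

context interval
begin

section \<open>Weak derivatives\<close>

lemma L2_bounded_limit:
  assumes "\<And>n. h n \<in> borel_measurable M" "g \<in> borel_measurable M"
    and "\<And>n x. x \<in> Om \<Longrightarrow> \<bar>h n x\<bar> \<le> B" "\<And>x. x \<in> Om \<Longrightarrow> \<bar>g x\<bar> \<le> B"
    and "AE x in M. (\<lambda>n. h n x) \<longlonglongrightarrow> g x"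
  shows "(\<lambda>n. L2norm Om (\<lambda>x. g x - h n x)) \<longlonglongrightarrow> 0"
proof -
  have "(\<lambda>n. LINT x|M. (g x - h n x)\<^sup>2) \<longlonglongrightarrow> (LINT x|M. 0)"
  proof (rule integral_dominated_convergence[where w="\<lambda>x. (2 * B)\<^sup>2"])
    show "AE x in M. (\<lambda>n. (g x - h n x)\<^sup>2) \<longlonglongrightarrow> 0"
      using assms(5)
    proof eventually_elim
      case (elim x)
      have "(\<lambda>n. (g x - h n x)\<^sup>2) \<longlonglongrightarrow> (g x - g x)\<^sup>2"
        by (intro tendsto_intros elim)
      then show ?case by simp
    qed
    show "AE x in M. norm ((g x - h n x)\<^sup>2) \<le> (2 * B)\<^sup>2" for n
    proof (rule AE_I2)
      fix x assume "x \<in> space M"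
      then have "\<bar>g x - h n x\<bar> \<le> 2 * B"
        using assms(3)[of x n] assms(4)[of x] by auto
      then show "norm ((g x - h n x)\<^sup>2) \<le> (2 * B)\<^sup>2"
        using abs_le_square_iff[of "g x - h n x" "2 * B"] by auto
    qed
  qed (use assms in \<open>auto intro!: borel_measurable_power borel_measurable_diff\<close>)
  from tendsto_real_sqrt[OF this] show ?thesis
    by (simp add: L2norm_def)
qed

text \<open>Test functions approximating \<open>sgn d\<close> boundedly almost everywhere yield \<open>\<integral> \<bar>d\<bar> = 0\<close>.\<close>

lemma L2_inner_test_functions_zero:
  assumes d: "d \<in> L2 Om" and orth: "\<And>\<phi>. \<phi> \<in> test_functions Om \<Longrightarrow> (LINT x|M. d x * \<phi> x) = 0"
  shows "AE x in M. d x = 0"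
proof -
  have sgn: "(\<lambda>x. sgn (d x)) \<in> borel_measurable M" "\<And>x. \<bar>sgn (d x)\<bar> \<le> 1"
    using L2_measurable[OF d] by (auto simp: sgn_real_def)
  obtain \<psi> where \<psi>: "\<And>n. \<psi> n \<in> test_functions Om" "\<And>n x. x \<in> Om \<Longrightarrow> \<bar>\<psi> n x\<bar> \<le> 1 + 1"
    "AE x in M. (\<lambda>n. \<psi> n x) \<longlonglongrightarrow> sgn (d x)"
    using bounded_approx_test_functions[OF sgn(1) sgn(2) L_pos] by blast
  have "(\<lambda>n. LINT x|M. d x * \<psi> n x) \<longlonglongrightarrow> (LINT x|M. d x * sgn (d x))"
  proof (rule integral_dominated_convergence[where w="\<lambda>x. \<bar>d x\<bar> * 2"])
    show "AE x in M. (\<lambda>n. d x * \<psi> n x) \<longlonglongrightarrow> d x * sgn (d x)"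
      using \<psi>(3) by eventually_elim (intro tendsto_intros)
    show "integrable M (\<lambda>x. \<bar>d x\<bar> * 2)"
      by (intro integrable_mult_left integrable_abs L2_integrable d)
    show "(\<lambda>x. d x * \<psi> n x) \<in> borel_measurable M" for n
      using L2_measurable[OF d] L2_measurable[OF test_functions_L2[OF \<psi>(1)]] by measurable
    show "(\<lambda>x. d x * sgn (d x)) \<in> borel_measurable M"
      using L2_measurable[OF d] sgn(1) by measurable
    show "AE x in M. norm (d x * \<psi> n x) \<le> \<bar>d x\<bar> * 2" for n
      using \<psi>(2) by (intro AE_I2) (auto simp: abs_mult intro!: mult_left_mono)
  qed
  then have "(LINT x|M. d x * sgn (d x)) = 0"
    using orth[OF \<psi>(1)] by (simp add: LIMSEQ_const_iff)
  then have "(LINT x|M. \<bar>d x\<bar>) = 0" by (simp add: flip: abs_sgn)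
  moreover have "integrable M (\<lambda>x. \<bar>d x\<bar>)"
    by (intro integrable_abs L2_integrable d)
  ultimately show ?thesis
    using integral_nonneg_eq_0_iff_AE[of M "\<lambda>x. \<bar>d x\<bar>"] by simp
qed

lemma test_functions_deriv_L2: "\<phi> \<in> test_functions Om \<Longrightarrow> deriv \<phi> \<in> L2 Om"
  by (intro test_functions_L2 deriv_test_functions)

text \<open>Makes the choice in \<open>weak_deriv\<close> immaterial up to null sets: the difference
  of two candidates is orthogonal to all test functions.\<close>

lemma has_weak_deriv_unique:
  assumes "g1 \<in> L2 Om" "g2 \<in> L2 Om" "has_weak_deriv Om u g1" "has_weak_deriv Om u g2"
  shows "AE x in M. g1 x = g2 x"
proof -
  have "AE x in M. g1 x - g2 x = 0"
  proof (rule L2_inner_test_functions_zero[OF L2_diff[OF assms(1,2)]])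
    fix \<phi> assume \<phi>: "\<phi> \<in> test_functions Om"
    then have "(LINT x|M. g1 x * \<phi> x) = (LINT x|M. g2 x * \<phi> x)"
      using assms(3,4) by (simp add: has_weak_deriv_def)
    then show "(LINT x|M. (g1 x - g2 x) * \<phi> x) = 0"
      using assms(1,2) \<phi> by (simp add: left_diff_distrib L2_mult_integrable test_functions_L2)
  qed
  then show ?thesis by simp
qed

lemma has_weak_deriv_cong_AE:
  assumes "has_weak_deriv Om u g" "u \<in> L2 Om" "v \<in> L2 Om" "AE x in M. u x = v x"
  shows "has_weak_deriv Om v g"
  unfolding has_weak_deriv_def
proof
  fix \<phi> assume \<phi>: "\<phi> \<in> test_functions Om"
  have "(LINT x|M. v x * deriv \<phi> x) = (LINT x|M. u x * deriv \<phi> x)"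
  proof (rule integral_cong_AE)
    show "AE x in M. v x * deriv \<phi> x = u x * deriv \<phi> x"
      using assms(4) by eventually_elim simp
  qed (intro borel_measurable_times L2_measurable[OF assms(2)] L2_measurable[OF assms(3)]
      L2_measurable[OF test_functions_L2[OF deriv_test_functions[OF \<phi>]]])+
  then show "(LINT x|M. v x * deriv \<phi> x) = - (LINT x|M. g x * \<phi> x)"
    using assms(1) \<phi> by (simp add: has_weak_deriv_def)
qed

lemma has_weak_deriv_linear:
  assumes "has_weak_deriv Om u g" "has_weak_deriv Om v h"
    and "u \<in> L2 Om" "v \<in> L2 Om" "g \<in> L2 Om" "h \<in> L2 Om"
  shows "has_weak_deriv Om (\<lambda>x. a * u x + b * v x) (\<lambda>x. a * g x + b * h x)"
  unfolding has_weak_deriv_def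
proof
  fix \<phi> assume \<phi>: "\<phi> \<in> test_functions Om"
  then have "(LINT x|M. u x * deriv \<phi> x) = - (LINT x|M. g x * \<phi> x)"
    and "(LINT x|M. v x * deriv \<phi> x) = - (LINT x|M. h x * \<phi> x)"
    using assms(1,2) by (auto simp: has_weak_deriv_def)
  then show "(LINT x|M. (a * u x + b * v x) * deriv \<phi> x) = - (LINT x|M. (a * g x + b * h x) * \<phi> x)"
    using assms(3-) \<phi>
    by (simp add: distrib_right mult.assoc L2_mult_integrable test_functions_L2 deriv_test_functions)
qed

text \<open>Integration by parts against \<open>deriv \<phi>\<close>, which has mean zero and
  primitive \<phi> because \<phi> vanishes near both endpoints.\<close>

lemma has_weak_deriv_prim:
  assumes "g \<in> L2 Om"
  shows "has_weak_deriv Om (prim g) g"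
  unfolding has_weak_deriv_def
proof
  fix \<phi> assume \<phi>: "\<phi> \<in> test_functions Om"
  have "(LINT x|M. prim g x * deriv \<phi> x) = - (LINT x|M. g x * prim (deriv \<phi>) x)"
    by (rule integral_prim_mult[OF assms test_functions_deriv_L2[OF \<phi>] integral_deriv_test_functions[OF \<phi>]])
  also have "(LINT x|M. g x * prim (deriv \<phi>) x) = (LINT x|M. g x * \<phi> x)"
    using \<phi> by (intro Bochner_Integration.integral_cong) (auto simp: prim_deriv_test_functions)
  finally show "(LINT x|M. prim g x * deriv \<phi> x) = - (LINT x|M. g x * \<phi> x)" .
qed

text \<open>On the interval \<phi> is the primitive of its derivative, so this is an instance of the
  rule for \<open>prim\<close>.\<close>

lemma has_weak_deriv_test_functions:
  assumes \<phi>: "\<phi> \<in> test_functions Om"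
  shows "has_weak_deriv Om \<phi> (deriv \<phi>)"
proof (rule has_weak_deriv_cong_AE[OF has_weak_deriv_prim])
  show "AE x in M. prim (deriv \<phi>) x = \<phi> x"
    using prim_deriv_test_functions[OF \<phi>] by (intro AE_I2) auto
qed (intro prim_L2 test_functions_deriv_L2 test_functions_L2 \<phi>)+

section \<open>The spaces H1 and H10\<close>

lemma H1_L2: "u \<in> H1 Om \<Longrightarrow> u \<in> L2 Om"
  by (simp add: H1_def)

lemma H1_weak_deriv:
  assumes "u \<in> H1 Om"
  shows "weak_deriv Om u \<in> L2 Om" "has_weak_deriv Om u (weak_deriv Om u)"
  using someI_ex[of "\<lambda>g. g \<in> L2 Om \<and> has_weak_deriv Om u g"] assms
  by (auto simp: H1_def weak_deriv_def)

lemma weak_deriv_AE_eq: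
  assumes "u \<in> L2 Om" "g \<in> L2 Om" "has_weak_deriv Om u g"
  shows "u \<in> H1 Om" "AE x in M. weak_deriv Om u x = g x"
proof -
  show "u \<in> H1 Om" using assms by (auto simp: H1_def)
  then show "AE x in M. weak_deriv Om u x = g x"
    using assms by (intro has_weak_deriv_unique[where u=u] H1_weak_deriv)
qed

text \<open>\<open>weak_deriv\<close> chooses a representative for each function separately, so it
  is linear almost everywhere only; uniqueness up to null sets relates the choices.\<close>

lemma H1_linear:
  assumes "u \<in> H1 Om" "v \<in> H1 Om"
  shows "(\<lambda>x. a * u x + b * v x) \<in> H1 Om"
    and "AE x in M. weak_deriv Om (\<lambda>x. a * u x + b * v x) x
          = a * weak_deriv Om u x + b * weak_deriv Om v x"
proof -
  note uv = H1_weak_deriv[OF assms(1)] H1_weak_deriv[OF assms(2)] H1_L2[OF assms(1)] H1_L2[OF assms(2)]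
  have "has_weak_deriv Om (\<lambda>x. a * u x + b * v x) (\<lambda>x. a * weak_deriv Om u x + b * weak_deriv Om v x)"
    by (intro has_weak_deriv_linear uv)
  then show "(\<lambda>x. a * u x + b * v x) \<in> H1 Om"
    and "AE x in M. weak_deriv Om (\<lambda>x. a * u x + b * v x) x
          = a * weak_deriv Om u x + b * weak_deriv Om v x"
    by (rule weak_deriv_AE_eq[rotated -1]; intro L2_add L2_cmult uv)+
qed

lemma test_functions_H1:
  assumes "\<phi> \<in> test_functions Om"
  shows "\<phi> \<in> H1 Om" "AE x in M. weak_deriv Om \<phi> x = deriv \<phi> x"
  by (rule weak_deriv_AE_eq[OF test_functions_L2[OF assms] test_functions_deriv_L2[OF assms]
        has_weak_deriv_test_functions[OF assms]])+

lemma H1_norm_alt: "H1_norm Om u = sqrt ((L2norm Om u)\<^sup>2 + (L2norm Om (weak_deriv Om u))\<^sup>2)"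
  by (simp add: H1_norm_def L2norm_square)

lemma L2norm_le_H1_norm: "L2norm Om u \<le> H1_norm Om u"
  and L2norm_weak_deriv_le_H1_norm: "L2norm Om (weak_deriv Om u) \<le> H1_norm Om u"
  unfolding H1_norm_alt by (rule real_le_rsqrt; simp)+

lemma H1_norm_le_add: "H1_norm Om u \<le> L2norm Om u + L2norm Om (weak_deriv Om u)"
  unfolding H1_norm_alt by (rule sqrt_sum_squares_le_sum) auto

lemma H1_diff:
  assumes "u \<in> H1 Om" "v \<in> H1 Om"
  shows "(\<lambda>x. u x - v x) \<in> H1 Om"
    and "AE x in M. weak_deriv Om (\<lambda>x. u x - v x) x = weak_deriv Om u x - weak_deriv Om v x"
  using H1_linear[OF assms, of 1 "-1"] by simp_all

lemma H10_H1: "u \<in> H10 Om \<Longrightarrow> u \<in> H1 Om"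
  by (simp add: H10_def)

lemma L2norm_weak_deriv_diff_test:
  assumes "u \<in> H1 Om" "\<phi> \<in> test_functions Om"
  shows "L2norm Om (weak_deriv Om (\<lambda>x. u x - \<phi> x)) = L2norm Om (\<lambda>x. weak_deriv Om u x - deriv \<phi> x)"
proof (rule L2norm_cong_AE)
  show "AE x in M. weak_deriv Om (\<lambda>x. u x - \<phi> x) x = weak_deriv Om u x - deriv \<phi> x"
    using H1_diff(2)[OF assms(1) test_functions_H1(1)[OF assms(2)]] test_functions_H1(2)[OF assms(2)]
    by eventually_elim simp
qed (intro L2_measurable L2_diff H1_weak_deriv(1) H1_diff(1) test_functions_H1(1)
      test_functions_deriv_L2 assms)+

text \<open>The norm of u - \<phi> in the definition involves a freshly chosen weak derivative of
  the difference. Here it is replaced by the difference of \<open>weak_deriv Om u\<close> and the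
  classical derivative, which can be computed with.\<close>

lemma H10_iff:
  "u \<in> H10 Om \<longleftrightarrow> u \<in> H1 Om \<and> (\<forall>\<epsilon>>0. \<exists>\<phi>\<in>test_functions Om.
     L2norm Om (\<lambda>x. u x - \<phi> x) < \<epsilon> \<and> L2norm Om (\<lambda>x. weak_deriv Om u x - deriv \<phi> x) < \<epsilon>)"
  (is "_ \<longleftrightarrow> _ \<and> ?R")
proof (cases "u \<in> H1 Om")
  case u: True
  have "(\<forall>\<epsilon>>0. \<exists>\<phi>\<in>test_functions Om. H1_norm Om (\<lambda>x. u x - \<phi> x) < \<epsilon>) \<longleftrightarrow> ?R"
  proof (intro iffI allI impI)
    fix \<epsilon> :: real
    assume "\<forall>\<epsilon>>0. \<exists>\<phi>\<in>test_functions Om. H1_norm Om (\<lambda>x. u x - \<phi> x) < \<epsilon>" "0 < \<epsilon>"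
    then obtain \<phi> where \<phi>: "\<phi> \<in> test_functions Om" "H1_norm Om (\<lambda>x. u x - \<phi> x) < \<epsilon>" by blast
    with L2norm_le_H1_norm[of "\<lambda>x. u x - \<phi> x"] L2norm_weak_deriv_le_H1_norm[of "\<lambda>x. u x - \<phi> x"]
    show "\<exists>\<phi>\<in>test_functions Om.
        L2norm Om (\<lambda>x. u x - \<phi> x) < \<epsilon> \<and> L2norm Om (\<lambda>x. weak_deriv Om u x - deriv \<phi> x) < \<epsilon>"
      using L2norm_weak_deriv_diff_test[OF u \<phi>(1)] by (intro bexI[OF _ \<phi>(1)]) auto
  next
    fix \<epsilon> :: real
    assume R: ?R and "0 < \<epsilon>"
    then obtain \<phi> where \<phi>: "\<phi> \<in> test_functions Om" "L2norm Om (\<lambda>x. u x - \<phi> x) < \<epsilon> / 2"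
      "L2norm Om (\<lambda>x. weak_deriv Om u x - deriv \<phi> x) < \<epsilon> / 2"
      by (meson half_gt_zero)
    then show "\<exists>\<phi>\<in>test_functions Om. H1_norm Om (\<lambda>x. u x - \<phi> x) < \<epsilon>"
      using H1_norm_le_add[of "\<lambda>x. u x - \<phi> x"] L2norm_weak_deriv_diff_test[OF u \<phi>(1)]
      by (intro bexI[OF _ \<phi>(1)]) auto
  qed
  with u show ?thesis by (simp add: H10_def)
qed (simp add: H10_def)

lemma H10_approx:
  assumes "u \<in> H10 Om" "0 < \<epsilon>"
  obtains \<phi> where "\<phi> \<in> test_functions Om" "L2norm Om (\<lambda>x. u x - \<phi> x) < \<epsilon>"
    "L2norm Om (\<lambda>x. weak_deriv Om u x - deriv \<phi> x) < \<epsilon>"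
  using assms unfolding H10_iff by blast

lemma H10_add:
  assumes "u \<in> H10 Om" "v \<in> H10 Om"
  shows "(\<lambda>x. u x + v x) \<in> H10 Om"
  unfolding H10_iff
proof (intro conjI allI impI)
  have uv: "u \<in> H1 Om" "v \<in> H1 Om" using assms H10_H1 by auto
  then have D: "(\<lambda>x. u x + v x) \<in> H1 Om"
    "AE x in M. weak_deriv Om (\<lambda>x. u x + v x) x = weak_deriv Om u x + weak_deriv Om v x"
    using H1_linear[of u v 1 1] by simp_all
  then show "(\<lambda>x. u x + v x) \<in> H1 Om" by simp
  fix \<epsilon> :: real assume "0 < \<epsilon>"
  then have "0 < \<epsilon> / 2" by simp
  obtain \<phi> where \<phi>: "\<phi> \<in> test_functions Om" "L2norm Om (\<lambda>x. u x - \<phi> x) < \<epsilon> / 2"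
      "L2norm Om (\<lambda>x. weak_deriv Om u x - deriv \<phi> x) < \<epsilon> / 2"
    using H10_approx[OF assms(1) \<open>0 < \<epsilon> / 2\<close>] .
  obtain \<psi> where \<psi>: "\<psi> \<in> test_functions Om" "L2norm Om (\<lambda>x. v x - \<psi> x) < \<epsilon> / 2"
      "L2norm Om (\<lambda>x. weak_deriv Om v x - deriv \<psi> x) < \<epsilon> / 2"
    using H10_approx[OF assms(2) \<open>0 < \<epsilon> / 2\<close>] .
  let ?\<theta> = "\<lambda>x. \<phi> x + \<psi> x"
  have "deriv ?\<theta> = (\<lambda>x. deriv \<phi> x + deriv \<psi> x)"
    using \<phi>(1) \<psi>(1)
    by (intro ext DERIV_imp_deriv DERIV_add smooth_real_has_deriv test_functions_smooth)
  have "L2norm Om (\<lambda>x. u x + v x - ?\<theta> x) = L2norm Om (\<lambda>x. (u x - \<phi> x) + (v x - \<psi> x))"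
    by (simp add: algebra_simps)
  also have "\<dots> \<le> L2norm Om (\<lambda>x. u x - \<phi> x) + L2norm Om (\<lambda>x. v x - \<psi> x)"
    by (intro L2norm_triangle L2_diff H1_L2[OF uv(1)] H1_L2[OF uv(2)] test_functions_L2 \<phi>(1) \<psi>(1))
  also have "\<dots> < \<epsilon>" using \<phi> \<psi> by simp
  finally have 1: "L2norm Om (\<lambda>x. u x + v x - ?\<theta> x) < \<epsilon>" .
  have "L2norm Om (\<lambda>x. weak_deriv Om (\<lambda>x. u x + v x) x - deriv ?\<theta> x) =
      L2norm Om (\<lambda>x. (weak_deriv Om u x - deriv \<phi> x) + (weak_deriv Om v x - deriv \<psi> x))"
  proof (rule L2norm_cong_AE)
    show "AE x in M. weak_deriv Om (\<lambda>x. u x + v x) x - deriv ?\<theta> x =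
        (weak_deriv Om u x - deriv \<phi> x) + (weak_deriv Om v x - deriv \<psi> x)"
      using D(2) by eventually_elim (simp add: \<open>deriv ?\<theta> = _\<close>)
  qed (auto simp: \<open>deriv ?\<theta> = _\<close> intro!: L2_measurable L2_diff L2_add H1_weak_deriv(1)
      test_functions_deriv_L2 uv D(1) \<phi>(1) \<psi>(1))
  also have "\<dots> \<le> L2norm Om (\<lambda>x. weak_deriv Om u x - deriv \<phi> x) + L2norm Om (\<lambda>x. weak_deriv Om v x - deriv \<psi> x)"
    using uv \<phi>(1) \<psi>(1)
    by (intro L2norm_triangle L2_diff H1_weak_deriv(1) test_functions_deriv_L2)
  also have "\<dots> < \<epsilon>" using \<phi> \<psi> by simp
  finally show "\<exists>\<phi>\<in>test_functions Om. L2norm Om (\<lambda>x. u x + v x - \<phi> x) < \<epsilon> \<and>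
      L2norm Om (\<lambda>x. weak_deriv Om (\<lambda>x. u x + v x) x - deriv \<phi> x) < \<epsilon>"
    using 1 \<phi>(1) \<psi>(1) by (intro bexI[of _ ?\<theta>] conjI test_functions_add)
qed

lemma H10_cmult:
  assumes "u \<in> H10 Om"
  shows "(\<lambda>x. c * u x) \<in> H10 Om"
  unfolding H10_iff
proof (intro conjI allI impI)
  have u: "u \<in> H1 Om" using assms H10_H1 by auto
  then have D: "(\<lambda>x. c * u x) \<in> H1 Om"
    "AE x in M. weak_deriv Om (\<lambda>x. c * u x) x = c * weak_deriv Om u x"
    using H1_linear[of u u c 0] by simp_all
  then show "(\<lambda>x. c * u x) \<in> H1 Om" by simp
  fix \<epsilon> :: real assume "0 < \<epsilon>"
  \<comment> \<open>The summand 1 covers c = 0.\<close>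
  then have "0 < \<epsilon> / (\<bar>c\<bar> + 1)" by simp
  with H10_approx[OF assms] obtain \<phi> where \<phi>: "\<phi> \<in> test_functions Om" "L2norm Om (\<lambda>x. u x - \<phi> x) < \<epsilon> / (\<bar>c\<bar> + 1)"
      "L2norm Om (\<lambda>x. weak_deriv Om u x - deriv \<phi> x) < \<epsilon> / (\<bar>c\<bar> + 1)"
    by blast
  have small: "\<bar>c\<bar> * y < \<epsilon>" if "y < \<epsilon> / (\<bar>c\<bar> + 1)" "0 \<le> y" for y
  proof -
    have "(\<bar>c\<bar> + 1) * y < \<epsilon>" using that by (simp add: field_simps)
    with that(2) show ?thesis using \<open>0 < \<epsilon>\<close> by (cases "y = 0") (auto simp: algebra_simps)
  qed
  let ?\<theta> = "\<lambda>x. c * \<phi> x"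
  have "deriv ?\<theta> = (\<lambda>x. c * deriv \<phi> x)"
    using \<phi>(1) by (intro ext DERIV_imp_deriv DERIV_cmult smooth_real_has_deriv test_functions_smooth)
  have 1: "L2norm Om (\<lambda>x. c * u x - ?\<theta> x) < \<epsilon>"
    using small[OF \<phi>(2)] L2norm_cmult[of Om c "\<lambda>x. u x - \<phi> x"] by (simp add: right_diff_distrib)
  have "L2norm Om (\<lambda>x. weak_deriv Om (\<lambda>x. c * u x) x - deriv ?\<theta> x) =
      L2norm Om (\<lambda>x. c * (weak_deriv Om u x - deriv \<phi> x))"
  proof (rule L2norm_cong_AE)
    show "AE x in M. weak_deriv Om (\<lambda>x. c * u x) x - deriv ?\<theta> x = c * (weak_deriv Om u x - deriv \<phi> x)"
      using D(2) by eventually_elim (simp add: \<open>deriv ?\<theta> = _\<close> right_diff_distrib)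
  qed (auto simp: \<open>deriv ?\<theta> = _\<close> intro!: L2_measurable L2_diff L2_cmult H1_weak_deriv(1)
      test_functions_deriv_L2 u D(1) \<phi>(1))
  also have "\<dots> < \<epsilon>"
    using small[OF \<phi>(3)] by (simp add: L2norm_cmult)
  finally show "\<exists>\<phi>\<in>test_functions Om. L2norm Om (\<lambda>x. c * u x - \<phi> x) < \<epsilon> \<and>
      L2norm Om (\<lambda>x. weak_deriv Om (\<lambda>x. c * u x) x - deriv \<phi> x) < \<epsilon>"
    using 1 \<phi>(1) by (intro bexI[of _ ?\<theta>] conjI test_functions_cmult)
qed

section \<open>Elements of H10 as primitives of functions with mean zero\<close>

text \<open>Both properties hold for test functions and are continuous in the H1 norm, so they pass
  to the closure. Together they express that the continuous representative vanishes at 0 and at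
  L.\<close>

lemma H10_prim_representation:
  assumes "u \<in> H10 Om"
  shows "AE x in M. u x = prim (weak_deriv Om u) x" "(LINT x|M. weak_deriv Om u x) = 0"
proof -
  let ?g = "weak_deriv Om u"
  have u: "u \<in> H1 Om" "u \<in> L2 Om" "?g \<in> L2 Om"
    using assms H10_H1 H1_L2 H1_weak_deriv by auto
  have "L2norm Om (\<lambda>x. u x - prim ?g x) \<le> 0"
  proof (rule field_le_epsilon)
    fix e :: real assume "0 < e"
    \<comment> \<open>The share 1 pays for u - \<phi>, the share L for the primitive of the
      derivative error through the Poincare inequality.\<close>
    then have "0 < e / (1 + L)" using L_pos by simp
    then obtain \<phi> where \<phi>: "\<phi> \<in> test_functions Om" "L2norm Om (\<lambda>x. u x - \<phi> x) < e / (1 + L)"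
      "L2norm Om (\<lambda>x. ?g x - deriv \<phi> x) < e / (1 + L)"
      using H10_approx[OF assms] by blast
    have \<phi>2: "\<phi> \<in> L2 Om" "deriv \<phi> \<in> L2 Om"
      by (intro test_functions_L2 test_functions_deriv_L2 \<phi>(1))+
    let ?d = "\<lambda>x. ?g x - deriv \<phi> x"
    have d: "?d \<in> L2 Om" by (intro L2_diff u \<phi>2)
    have "L2norm Om (\<lambda>x. u x - prim ?g x) = L2norm Om (\<lambda>x. (u x - \<phi> x) - prim ?d x)"
    proof (rule L2norm_cong_AE)
      show "AE x in M. u x - prim ?g x = (u x - \<phi> x) - prim ?d x"
        using u \<phi>2 \<phi>(1) by (intro AE_I2) (simp add: prim_diff prim_deriv_test_functions)
    qed (use u \<phi>2 d in \<open>auto intro!: L2_measurable L2_diff prim_L2\<close>)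
    also have "\<dots> \<le> L2norm Om (\<lambda>x. u x - \<phi> x) + L2norm Om (prim ?d)"
      by (intro L2norm_triangle_diff L2_diff u \<phi>2 prim_L2)
    also have "\<dots> \<le> e / (1 + L) + L * (e / (1 + L))"
      using \<phi>(2,3) L_pos order_trans[OF prim_L2norm_le[OF d] mult_left_mono[of _ "e / (1 + L)"]]
      by (intro add_mono) auto
    also have "\<dots> = (1 + L) * (e / (1 + L))" by (simp only: distrib_right mult_1)
    also have "\<dots> = e" using L_pos by simp
    finally show "L2norm Om (\<lambda>x. u x - prim ?g x) \<le> 0 + e" by simp
  qed
  then have "L2norm Om (\<lambda>x. u x - prim ?g x) = 0"
    using L2norm_nonneg[of Om] by (simp add: antisym)
  then have "AE x in M. u x - prim ?g x = 0"
    by (intro L2norm_eq_0_AE L2_diff u prim_L2)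
  then show "AE x in M. u x = prim ?g x" by simp
  have "\<bar>LINT x|M. ?g x\<bar> \<le> 0"
  proof (rule field_le_epsilon)
    fix e :: real assume "0 < e"
    then have "0 < e / sqrt L" using L_pos by simp
    then obtain \<phi> where \<phi>: "\<phi> \<in> test_functions Om"
      "L2norm Om (\<lambda>x. ?g x - deriv \<phi> x) < e / sqrt L"
      using H10_approx[OF assms] by blast
    have d: "deriv \<phi> \<in> L2 Om" "(\<lambda>x. ?g x - deriv \<phi> x) \<in> L2 Om"
      using \<phi>(1) u by (auto intro: test_functions_L2 deriv_test_functions L2_diff)
    have "(LINT x|M. ?g x) = prim (\<lambda>x. ?g x - deriv \<phi> x) L"
      using u d \<phi>(1) by (simp add: prim_diff) (simp add: prim_ge integral_deriv_test_functions)
    also have "\<bar>\<dots>\<bar> \<le> sqrt L * L2norm Om (\<lambda>x. ?g x - deriv \<phi> x)"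
      using prim_holder[OF d(2), of L 0] L_pos by (simp add: prim_nonpos)
    also have "\<dots> \<le> sqrt L * (e / sqrt L)"
      using \<phi>(2) L_pos by (intro mult_left_mono) auto
    also have "\<dots> = e" using L_pos by simp
    finally show "\<bar>LINT x|M. ?g x\<bar> \<le> 0 + e" by simp
  qed
  then show "(LINT x|M. ?g x) = 0" by simp
qed

text \<open>A primitive of \<theta> is constant on either side of the support. Normalized at 0 it is
  zero on the left, and the vanishing mean makes it zero on the right.\<close>

lemma test_function_antideriv:
  assumes \<theta>: "\<theta> \<in> test_functions Om" "(LINT x|M. \<theta> x) = 0"
  obtains \<Phi> where "\<Phi> \<in> test_functions Om" "deriv \<Phi> = \<theta>"
proof -
  have smooth: "smooth_real \<theta>" by (rule test_functions_smooth[OF \<theta>(1)])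
  obtain a b where ab: "0 < a" "a \<le> b" "b < L" "\<And>x. x \<notin> {a..b} \<Longrightarrow> \<theta> x = 0"
    using test_functions_support[OF \<theta>(1) L_pos] by blast
  \<comment> \<open>The primitive has to be differentiable on the whole line, hence the infinite
    endpoints.\<close>
  have "\<exists>F. \<forall>x. - \<infinity> < ereal x \<longrightarrow> ereal x < \<infinity> \<longrightarrow> (F has_vector_derivative \<theta> x) (at x)"
    using smooth_real_continuous[OF smooth]
    by (intro einterval_antiderivative) (auto simp: continuous_on_eq_continuous_at)
  then obtain F where F: "\<And>x. (F has_real_derivative \<theta> x) (at x)"
    by (auto simp: has_real_derivative_iff_has_vector_derivative)
  define \<Phi> where "\<Phi> x = F x - F 0" for x
  have d: "(\<Phi> has_real_derivative \<theta> x) (at x)" for x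
    unfolding \<Phi>_def by (auto intro!: derivative_eq_intros F)
  have const: "\<Phi> y = \<Phi> x" if "x < y" "y \<le> a \<or> b \<le> x" for x y
  proof (rule DERIV_isconst_end[OF that(1)])
    show "continuous_on {x..y} \<Phi>"
      using d by (meson DERIV_isCont continuous_at_imp_continuous_on)
    fix z assume "x < z" "z < y"
    then have "\<theta> z = 0" using that ab(4)[of z] by auto
    then show "(\<Phi> has_real_derivative 0) (at z)" using d[of z] by simp
  qed
  have "F L - F 0 = 0"
    using prim_FTC[OF F smooth_real_continuous[OF smooth], of L] \<theta>(2) L_pos by (simp add: prim_ge)
  then have "\<Phi> L = 0" "\<Phi> 0 = 0" by (auto simp: \<Phi>_def)
  have zero: "\<Phi> x = 0" if "x \<notin> {a..b}" for x
  proof (cases "x < a")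
    case True
    with const[of x 0] const[of 0 x] ab \<open>\<Phi> 0 = 0\<close> show ?thesis
      by (cases x "0 :: real" rule: linorder_cases) auto
  next
    case False
    with const[of x L] const[of L x] ab \<open>\<Phi> L = 0\<close> that show ?thesis
      by (cases x L rule: linorder_cases) auto
  qed
  have "\<Phi> \<in> test_functions Om"
    using ab by (intro test_functionsI[where a=a and b=b] smooth_real_antideriv[OF d smooth] zero) auto
  moreover have "deriv \<Phi> = \<theta>" using d by (intro ext DERIV_imp_deriv)
  ultimately show ?thesis using that by blast
qed

text \<open>If every test function had integral zero, the constant 1 would be orthogonal to all of
  them and hence vanish almost everywhere. This spares an explicit bump and the estimate of its
  integral.\<close>

lemma test_function_integral_one:
  obtains \<eta> where "\<eta> \<in> test_functions Om" "(LINT x|M. \<eta> x) = 1"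
proof -
  have one: "(\<lambda>x. 1) \<in> borel_measurable M" "\<And>x. x \<in> Om \<Longrightarrow> \<bar>1 :: real\<bar> \<le> 1" by auto
  have "\<exists>\<phi>\<in>test_functions Om. (LINT x|M. \<phi> x) \<noteq> 0"
  proof (rule ccontr)
    assume "\<not> (\<exists>\<phi>\<in>test_functions Om. (LINT x|M. \<phi> x) \<noteq> 0)"
    then have "AE x in M. (1 :: real) = 0"
      by (intro L2_inner_test_functions_zero bounded_L2[OF one]) auto
    then have "emeasure M {x \<in> space M. \<not> (1 :: real) = 0} = 0"
      by (rule AE_E2)
    also have "{x \<in> space M. \<not> (1 :: real) = 0} = Om" by auto
    finally have "measure M Om = 0" by (simp add: measure_def)
    then show False using L_pos by (simp add: measure_M)
  qed
  then obtain \<phi> where \<phi>: "\<phi> \<in> test_functions Om" "(LINT x|M. \<phi> x) \<noteq> 0" by blast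
  show ?thesis
    using \<phi> that[OF test_functions_cmult[OF \<phi>(1), of "1 / (LINT x|M. \<phi> x)"]] by simp
qed

text \<open>Converse of \<open>H10_prim_representation\<close> for bounded g. The approximating test
  functions \<open>\<psi> n\<close> are corrected to mean zero by a multiple of \<eta>, since only
  then do they have primitives that are test functions. The correction tends to zero because g
  itself has mean zero.\<close>

lemma prim_H10:
  assumes g: "g \<in> borel_measurable M" "\<And>x. x \<in> Om \<Longrightarrow> \<bar>g x\<bar> \<le> B" and g0: "(LINT x|M. g x) = 0"
  shows "prim g \<in> H10 Om" "AE x in M. weak_deriv Om (prim g) x = g x"
proof -
  have gL2: "g \<in> L2 Om" using g by (rule bounded_L2)
  have D: "prim g \<in> H1 Om" "AE x in M. weak_deriv Om (prim g) x = g x"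
    by (rule weak_deriv_AE_eq[OF prim_L2[OF gL2] gL2 has_weak_deriv_prim[OF gL2]])+
  then show "AE x in M. weak_deriv Om (prim g) x = g x" by simp
  obtain \<psi> where \<psi>: "\<And>n. \<psi> n \<in> test_functions Om" "\<And>n x. x \<in> Om \<Longrightarrow> \<bar>\<psi> n x\<bar> \<le> B + 1"
    "AE x in M. (\<lambda>n. \<psi> n x) \<longlonglongrightarrow> g x"
    using bounded_approx_test_functions[OF g L_pos] by blast
  have \<psi>L2: "\<psi> n \<in> L2 Om" for n by (rule test_functions_L2[OF \<psi>(1)])
  have lim: "(\<lambda>n. L2norm Om (\<lambda>x. g x - \<psi> n x)) \<longlonglongrightarrow> 0"
  proof (rule L2_bounded_limit[where B="B + 1"])
    show "\<bar>g x\<bar> \<le> B + 1" if "x \<in> Om" for x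
      using g(2)[OF that] by simp
  qed (use \<psi> g(1) L2_measurable[OF \<psi>L2] in auto)
  obtain \<eta> where \<eta>: "\<eta> \<in> test_functions Om" "(LINT x|M. \<eta> x) = 1"
    using test_function_integral_one .
  have \<eta>L2: "\<eta> \<in> L2 Om" by (rule test_functions_L2[OF \<eta>(1)])
  define m where "m n = (LINT x|M. \<psi> n x)" for n
  have m: "\<bar>m n\<bar> \<le> sqrt L * L2norm Om (\<lambda>x. g x - \<psi> n x)" for n
  proof -
    have "- m n = prim (\<lambda>x. g x - \<psi> n x) L"
      using g0 by (simp add: prim_diff gL2 \<psi>L2) (simp add: prim_ge m_def)
    then show ?thesis
      using prim_holder[OF L2_diff[OF gL2 \<psi>L2], of n L 0] L_pos by (simp add: prim_nonpos)
  qed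
  define \<theta> where "\<theta> n x = \<psi> n x + (- m n) * \<eta> x" for n x
  have \<theta>: "\<theta> n \<in> test_functions Om" "(LINT x|M. \<theta> n x) = 0" for n
  proof -
    show "\<theta> n \<in> test_functions Om"
      unfolding \<theta>_def by (rule test_functions_add[OF \<psi>(1) test_functions_cmult[OF \<eta>(1)]])
    show "(LINT x|M. \<theta> n x) = 0"
      unfolding \<theta>_def using \<eta>(2) by (simp add: L2_integrable \<psi>L2 \<eta>L2 flip: m_def)
  qed
  have le: "L2norm Om (\<lambda>x. g x - \<theta> n x) \<le> (1 + sqrt L * L2norm Om \<eta>) * L2norm Om (\<lambda>x. g x - \<psi> n x)" for n
  proof -
    have "L2norm Om (\<lambda>x. g x - \<theta> n x) = L2norm Om (\<lambda>x. (g x - \<psi> n x) + m n * \<eta> x)"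
      by (simp add: \<theta>_def algebra_simps)
    also have "\<dots> \<le> L2norm Om (\<lambda>x. g x - \<psi> n x) + \<bar>m n\<bar> * L2norm Om \<eta>"
      using L2norm_triangle[OF L2_diff[OF gL2 \<psi>L2] L2_cmult[OF \<eta>L2]] by (simp add: L2norm_cmult)
    also have "\<dots> \<le> L2norm Om (\<lambda>x. g x - \<psi> n x) + (sqrt L * L2norm Om (\<lambda>x. g x - \<psi> n x)) * L2norm Om \<eta>"
      using m by (intro add_left_mono mult_right_mono) auto
    finally show ?thesis by (simp add: algebra_simps)
  qed
  have lim\<theta>: "(\<lambda>n. L2norm Om (\<lambda>x. g x - \<theta> n x)) \<longlonglongrightarrow> 0"
  proof (rule Lim_null_comparison)
    show "(\<lambda>n. (1 + sqrt L * L2norm Om \<eta>) * L2norm Om (\<lambda>x. g x - \<psi> n x)) \<longlonglongrightarrow> 0"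
      using lim by (rule tendsto_mult_right_zero)
  qed (use le in simp)
  show "prim g \<in> H10 Om"
    unfolding H10_iff
  proof (intro conjI allI impI D)
    fix \<epsilon> :: real assume "0 < \<epsilon>"
    then have "0 < \<epsilon> / (1 + L)" using L_pos by simp
    with lim\<theta> obtain n where n: "L2norm Om (\<lambda>x. g x - \<theta> n x) < \<epsilon> / (1 + L)"
      by (metis (no_types, lifting) eventually_sequentially order_refl order_tendstoD(2))
    obtain \<Phi> where \<Phi>: "\<Phi> \<in> test_functions Om" "deriv \<Phi> = \<theta> n"
      using test_function_antideriv[OF \<theta>] .
    have \<theta>L2: "\<theta> n \<in> L2 Om" by (rule test_functions_L2[OF \<theta>(1)])
    have small: "(1 + L) * L2norm Om (\<lambda>x. g x - \<theta> n x) < \<epsilon>"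
      using n L_pos by (simp add: field_simps)
    have "L2norm Om (\<lambda>x. prim g x - \<Phi> x) = L2norm Om (prim (\<lambda>x. g x - \<theta> n x))"
    proof (rule L2norm_cong_AE)
      show "AE x in M. prim g x - \<Phi> x = prim (\<lambda>x. g x - \<theta> n x) x"
        using prim_deriv_test_functions[OF \<Phi>(1)] by (intro AE_I2) (simp add: prim_diff gL2 \<theta>L2 \<Phi>(2))
    qed (intro L2_measurable L2_diff prim_L2 gL2 \<theta>L2 test_functions_L2[OF \<Phi>(1)])+
    also have "\<dots> \<le> L * L2norm Om (\<lambda>x. g x - \<theta> n x)"
      by (intro prim_L2norm_le L2_diff gL2 \<theta>L2)
    also have "\<dots> < \<epsilon>"
    proof -
      have "0 \<le> L2norm Om (\<lambda>x. g x - \<theta> n x)" by simp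
      with small show ?thesis by (simp only: distrib_right mult_1)
    qed
    finally have 1: "L2norm Om (\<lambda>x. prim g x - \<Phi> x) < \<epsilon>" .
    have "L2norm Om (\<lambda>x. weak_deriv Om (prim g) x - deriv \<Phi> x) = L2norm Om (\<lambda>x. g x - \<theta> n x)"
    proof (rule L2norm_cong_AE)
      show "AE x in M. weak_deriv Om (prim g) x - deriv \<Phi> x = g x - \<theta> n x"
        using D(2) by eventually_elim (simp add: \<Phi>(2))
    qed (use D \<Phi>(2) in \<open>auto intro!: L2_measurable L2_diff gL2 \<theta>L2 H1_weak_deriv\<close>)
    also have "\<dots> < \<epsilon>"
    proof -
      have "0 \<le> L * L2norm Om (\<lambda>x. g x - \<theta> n x)" using L_pos by simp
      with small show ?thesis by (simp only: distrib_right mult_1)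
    qed
    finally show "\<exists>\<phi>\<in>test_functions Om. L2norm Om (\<lambda>x. prim g x - \<phi> x) < \<epsilon> \<and>
        L2norm Om (\<lambda>x. weak_deriv Om (prim g) x - deriv \<phi> x) < \<epsilon>"
      using 1 \<Phi>(1) by blast
  qed
qed

end

section \<open>Frozen coefficients\<close>

lemma weighted_integrable:
  assumes "a \<in> borel_measurable (lebesgue_on S)" "\<And>x. x \<in> S \<Longrightarrow> \<bar>a x\<bar> \<le> k"
    and "g \<in> L2 S" "h \<in> L2 S"
  shows "integrable (lebesgue_on S) (\<lambda>x. a x * g x * h x)"
  by (rule L2_mult_integrable[OF L2_bounded_mult(1)[OF assms(1,2,3)] assms(4)])

lemma weighted_integral_bound:
  assumes "a \<in> borel_measurable (lebesgue_on S)" "\<And>x. x \<in> S \<Longrightarrow> \<bar>a x\<bar> \<le> k"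
    and "g \<in> L2 S" "h \<in> L2 S"
  shows "\<bar>LINT x|lebesgue_on S. a x * g x * h x\<bar> \<le> k * L2norm S g * L2norm S h"
  by (rule order_trans[OF L2_Cauchy_Schwarz[OF L2_bounded_mult(1)[OF assms(1,2,3)] assms(4)]
        mult_right_mono[OF L2_bounded_mult(2)[OF assms(1,2,3)]]]) simp_all

lemma weighted_integral_coercive:
  assumes "a \<in> borel_measurable (lebesgue_on S)" "\<And>x. x \<in> S \<Longrightarrow> \<bar>a x\<bar> \<le> k"
    and "\<And>x. x \<in> S \<Longrightarrow> c \<le> a x" and "g \<in> L2 S"
  shows "c * (L2norm S g)\<^sup>2 \<le> (LINT x|lebesgue_on S. a x * g x * g x)"
proof -
  have "c * (L2norm S g)\<^sup>2 = (LINT x|lebesgue_on S. c * (g x)\<^sup>2)"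
    by (simp add: L2norm_square)
  also have "\<dots> \<le> (LINT x|lebesgue_on S. a x * g x * g x)"
  proof (rule integral_mono)
    show "integrable (lebesgue_on S) (\<lambda>x. c * (g x)\<^sup>2)"
      by (intro integrable_mult_right L2_square_integrable assms)
    show "integrable (lebesgue_on S) (\<lambda>x. a x * g x * g x)"
      by (intro weighted_integrable[where k=k] assms)
    show "c * (g x)\<^sup>2 \<le> a x * g x * g x" if "x \<in> space (lebesgue_on S)" for x
      using assms(3)[of x] that by (simp add: power2_eq_square mult.assoc mult_right_mono)
  qed
  finally show ?thesis .
qed

context interval
begin

text \<open>Rests on the completeness of Lebesgue measure. It transfers measurability from a
  coefficient evaluated along a continuous representative to the coefficient along the given
  function.\<close>

lemma borel_measurable_cong_AE:
  assumes "f \<in> borel_measurable M" "AE x in M. f x = g x"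
  shows "(g :: real \<Rightarrow> real) \<in> borel_measurable M"
proof -
  have "(\<lambda>x. if x \<in> Om then f x else 0) \<in> borel_measurable lebesgue"
    using assms(1) by (simp add: borel_measurable_if del: greaterThanLessThan_iff)
  moreover have "AE x in lebesgue. x \<in> Om \<longrightarrow> f x = g x"
    using assms(2) by (subst (asm) AE_restrict_space_iff) auto
  then have "AE x in lebesgue. (if x \<in> Om then f x else 0) = (if x \<in> Om then g x else 0)"
    by eventually_elim simp
  ultimately have "(\<lambda>x. if x \<in> Om then g x else 0) \<in> borel_measurable lebesgue"
    by (rule borel_measurable_AE)
  then show ?thesis
    by (simp add: borel_measurable_if del: greaterThanLessThan_iff)
qed

lemma H10_diff:
  assumes "u \<in> H10 Om" "v \<in> H10 Om"
  shows "(\<lambda>x. u x - v x) \<in> H10 Om"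
  using H10_add[OF assms(1) H10_cmult[OF assms(2), of "-1"]] by simp

lemma strong_imp_weakly_converges:
  assumes U: "\<And>n. U n \<in> H10 Om" and u: "u \<in> H10 Om"
    and lim: "(\<lambda>n. H1_norm Om (\<lambda>x. U n x - u x)) \<longlonglongrightarrow> 0"
  shows "weakly_converges_H10 Om U u"
  unfolding weakly_converges_H10_def
proof (intro conjI allI impI U u)
  fix F assume F: "bounded_functional_H10 Om F"
  then obtain C where C: "\<And>v. v \<in> H10 Om \<Longrightarrow> \<bar>F v\<bar> \<le> C * H1_norm Om v"
    and add: "\<And>v w. v \<in> H10 Om \<Longrightarrow> w \<in> H10 Om \<Longrightarrow> F (\<lambda>x. v x + w x) = F v + F w"
    unfolding bounded_functional_H10_def by blast
  have "F (U n) = F (\<lambda>x. U n x - u x) + F u" for n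
    using add[OF H10_diff[OF U u] u, of n] by simp
  moreover have "(\<lambda>n. F (\<lambda>x. U n x - u x)) \<longlonglongrightarrow> 0"
  proof (rule Lim_null_comparison)
    show "(\<lambda>n. C * H1_norm Om (\<lambda>x. U n x - u x)) \<longlonglongrightarrow> 0"
      using lim by (rule tendsto_mult_right_zero)
    show "\<forall>\<^sub>F n in sequentially. norm (F (\<lambda>x. U n x - u x)) \<le> C * H1_norm Om (\<lambda>x. U n x - u x)"
      using C[OF H10_diff[OF U u]] by simp
  qed
  ultimately show "(\<lambda>n. F (U n)) \<longlonglongrightarrow> F u"
    using tendsto_add[of "\<lambda>n. F (\<lambda>x. U n x - u x)" 0 sequentially "\<lambda>n. F u" "F u"] by simp
qed

text \<open>Arzela-Ascoli for primitives, which are honest functions on [0, L]; the Hoelder estimate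
  supplies one modulus of continuity for all n.\<close>

lemma prim_subseq_uniform_limit:
  assumes g: "\<And>n. g n \<in> L2 Om" and R: "\<And>n. L2norm Om (g n) \<le> R"
  obtains G k where "continuous_on {0..L} G" "strict_mono (k :: nat \<Rightarrow> nat)"
    and "\<And>e. 0 < e \<Longrightarrow> \<forall>\<^sub>F n in sequentially. \<forall>x\<in>{0..L}. \<bar>prim (g (k n)) x - G x\<bar> < e"
proof -
  have R0: "0 \<le> R" using R[of 0] L2norm_nonneg[of Om "g 0"] by linarith
  have holder: "\<bar>prim (g n) x - prim (g n) y\<bar> \<le> sqrt \<bar>x - y\<bar> * R" for n x y
    by (rule order_trans[OF prim_holder[OF g] mult_left_mono[OF R]]) simp
  have "norm (prim (g n) x) \<le> sqrt L * R" if "x \<in> {0..L}" for n x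
  proof -
    have "norm (prim (g n) x) \<le> sqrt \<bar>x\<bar> * R"
      using holder[of n x 0] by (simp add: prim_nonpos)
    also have "\<dots> \<le> sqrt L * R" using that R0 by (intro mult_right_mono) auto
    finally show ?thesis .
  qed
  moreover have "\<exists>d. 0 < d \<and> (\<forall>n y. y \<in> {0..L} \<and> norm (x - y) < d \<longrightarrow>
      norm (prim (g n) x - prim (g n) y) < e)" if "0 < e" for x e :: real
  \<comment> \<open>The root of this radius times R + 1 is e, as the Hoelder estimate asks; R + 1 is
    positive even for R = 0.\<close>
  proof (intro exI[of _ "(e / (R + 1))\<^sup>2"] conjI allI impI)
    show "0 < (e / (R + 1))\<^sup>2" using that R0 by simp
    fix n y assume "y \<in> {0..L} \<and> norm (x - y) < (e / (R + 1))\<^sup>2"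
    then have "sqrt \<bar>x - y\<bar> < e / (R + 1)"
      using that R0 by (intro real_less_lsqrt) auto
    then have "sqrt \<bar>x - y\<bar> * (R + 1) < e"
      using R0 by (simp add: field_simps)
    moreover have "sqrt \<bar>x - y\<bar> * R \<le> sqrt \<bar>x - y\<bar> * (R + 1)"
      by (intro mult_left_mono) auto
    ultimately show "norm (prim (g n) x - prim (g n) y) < e"
      using holder[of n x y] by simp
  qed
  ultimately obtain G k where Gk: "continuous_on {0..L} G" "strict_mono (k :: nat \<Rightarrow> nat)"
    and unif: "\<And>e. 0 < e \<Longrightarrow> \<exists>N. \<forall>n x. n \<ge> N \<and> x \<in> {0..L} \<longrightarrow> norm (prim (g (k n)) x - G x) < e"
    using Arzela_Ascoli[of "{0..L}" "\<lambda>n. prim (g n)" "sqrt L * R"] by (metis compact_Icc)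
  have "\<forall>\<^sub>F n in sequentially. \<forall>x\<in>{0..L}. \<bar>prim (g (k n)) x - G x\<bar> < e" if e: "0 < e" for e
  proof -
    obtain N where "\<forall>n x. n \<ge> N \<and> x \<in> {0..L} \<longrightarrow> norm (prim (g (k n)) x - G x) < e"
      using unif[OF e] by blast
    then show ?thesis
      unfolding eventually_sequentially by (intro exI[of _ N]) simp
  qed
  with Gk show ?thesis by (rule that)
qed

end

text \<open>One coefficient on the whole interval, without reference to interfaces. Continuity in x
  may fail there, so only measurability along continuous arguments is asked for.\<close>

locale quasilinear = interval +
  fixes K :: "real \<Rightarrow> real \<Rightarrow> real" and k_min k_max C :: real and f :: "real \<Rightarrow> real"
  assumes k_min_pos: "0 < k_min"
    and K_range: "\<And>x z. x \<in> Om \<Longrightarrow> K x z \<in> {k_min..k_max}"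
    and K_lipschitz: "\<And>x y z. x \<in> Om \<Longrightarrow> \<bar>K x y - K x z\<bar> \<le> C * \<bar>y - z\<bar>"
    and K_measurable: "\<And>v. continuous_on {0..L} v \<Longrightarrow> (\<lambda>x. K x (v x)) \<in> borel_measurable M"
    and f_L2: "f \<in> L2 Om"
begin

lemma K_abs: "x \<in> Om \<Longrightarrow> \<bar>K x z\<bar> \<le> k_max"
  using K_range[of x z] k_min_pos by auto

lemma k_max_pos: "0 < k_max"
  using K_range[of "L / 2" 0] k_min_pos L_pos by auto

definition form :: "(real \<Rightarrow> real) \<Rightarrow> (real \<Rightarrow> real) \<Rightarrow> (real \<Rightarrow> real) \<Rightarrow> real" where
  "form v u w = (LINT x|M. K x (v x) * weak_deriv Om u x * weak_deriv Om w x)"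

lemma prim_continuous_on: "g \<in> L2 Om \<Longrightarrow> continuous_on S (prim g)"
  using continuous_on_subset[OF prim_continuous] by blast

lemma K_prim_measurable: "g \<in> L2 Om \<Longrightarrow> (\<lambda>x. K x (prim g x)) \<in> borel_measurable M"
  by (intro K_measurable prim_continuous_on)

lemma K_H10_measurable:
  assumes "v \<in> H10 Om"
  shows "(\<lambda>x. K x (v x)) \<in> borel_measurable M"
proof (rule borel_measurable_cong_AE[OF K_prim_measurable])
  show "weak_deriv Om v \<in> L2 Om" using assms H10_H1 H1_weak_deriv by blast
  show "AE x in M. K x (prim (weak_deriv Om v) x) = K x (v x)"
    using H10_prim_representation(1)[OF assms] by eventually_elim simp
qed

lemma H10_weak_deriv_L2: "v \<in> H10 Om \<Longrightarrow> weak_deriv Om v \<in> L2 Om"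
  by (intro H1_weak_deriv H10_H1)

lemma H10_L2: "v \<in> H10 Om \<Longrightarrow> v \<in> L2 Om"
  by (intro H1_L2 H10_H1)

lemma form_prim:
  assumes "v \<in> H10 Om" "u \<in> H10 Om" "w \<in> H10 Om"
  shows "form v u w = (LINT x|M. K x (prim (weak_deriv Om v) x) * weak_deriv Om u x * weak_deriv Om w x)"
  unfolding form_def
proof (rule integral_cong_AE)
  show "AE x in M. K x (v x) * weak_deriv Om u x * weak_deriv Om w x =
      K x (prim (weak_deriv Om v) x) * weak_deriv Om u x * weak_deriv Om w x"
    using H10_prim_representation(1)[OF assms(1)] by eventually_elim simp
qed (intro borel_measurable_times K_H10_measurable K_prim_measurable
    L2_measurable[OF H10_weak_deriv_L2] H10_weak_deriv_L2 assms)+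

lemma H10_load_bound:
  assumes "v \<in> H10 Om"
  shows "\<bar>form_l L f v\<bar> \<le> L2norm Om f * (L * L2norm Om (weak_deriv Om v))"
proof -
  let ?g = "weak_deriv Om v"
  have g: "?g \<in> L2 Om" by (rule H10_weak_deriv_L2[OF assms])
  have "\<bar>form_l L f v\<bar> \<le> L2norm Om f * L2norm Om v"
    unfolding form_l_def by (intro L2_Cauchy_Schwarz f_L2 H10_L2 assms)
  also have "L2norm Om v = L2norm Om (prim ?g)"
    by (intro L2norm_cong_AE H10_prim_representation(1) assms L2_measurable[OF H10_L2] prim_measurable g)
  also have "L2norm Om f * \<dots> \<le> L2norm Om f * (L * L2norm Om ?g)"
    by (intro mult_left_mono prim_L2norm_le g) simp
  finally show ?thesis .
qed

text \<open>Energy estimate: with the solution as its own test function, coercivity on the left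
  meets the Poincare bound of the load on the right. The bound is the same for all Galerkin
  spaces.\<close>

lemma galerkin_bound:
  assumes u: "u \<in> H10 Om" and eq: "form u u u = form_l L f u"
  shows "L2norm Om (weak_deriv Om u) \<le> L2norm Om f * L / k_min"
proof -
  let ?g = "weak_deriv Om u"
  have g: "?g \<in> L2 Om" by (rule H10_weak_deriv_L2[OF u])
  have "k_min * (L2norm Om ?g)\<^sup>2 \<le> form u u u"
    unfolding form_def
    by (rule weighted_integral_coercive[where k=k_max]) (use K_abs K_range K_H10_measurable[OF u] g in auto)
  also have "\<dots> \<le> L2norm Om f * (L * L2norm Om ?g)"
    using H10_load_bound[OF u] eq by simp
  finally have "(k_min * L2norm Om ?g) * L2norm Om ?g \<le> (L2norm Om f * L) * L2norm Om ?g"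
    by (simp add: power2_eq_square mult.assoc)
  \<comment> \<open>The common factor can be cancelled only if it is nonzero; if it is zero, the
    claim is immediate.\<close>
  then have "k_min * L2norm Om ?g \<le> L2norm Om f * L \<or> L2norm Om ?g = 0"
    using L2norm_nonneg[of Om ?g] by (cases "L2norm Om ?g = 0") (auto simp: mult_le_cancel_right less_le)
  then show ?thesis
    using k_min_pos L_pos by (auto simp: field_simps)
qed

text \<open>In one dimension the linear problem with a frozen coefficient \<open>A\<close> is solved by quadrature:
  \<open>- (A w')' = f\<close> means \<open>A w' = c - \<integral> f\<close>, and the boundary condition determines \<open>c\<close>.\<close>

lemma linear_problem_solution:
  assumes A: "A \<in> borel_measurable M" "\<And>x. x \<in> Om \<Longrightarrow> A x \<in> {k_min..k_max}"
  obtains g where "g \<in> L2 Om" "prim g \<in> H10 Om" "AE x in M. weak_deriv Om (prim g) x = g x"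
    and "\<And>v. v \<in> H10 Om \<Longrightarrow> (LINT x|M. A x * g x * weak_deriv Om v x) = form_l L f v"
proof -
  have pos: "0 < A x" if "x \<in> Om" for x
    using A(2)[OF that] k_min_pos by auto
  have inv: "(\<lambda>x. 1 / A x) \<in> borel_measurable M" "\<And>x. x \<in> Om \<Longrightarrow> \<bar>1 / A x\<bar> \<le> 1 / k_min"
  proof -
    show "(\<lambda>x. 1 / A x) \<in> borel_measurable M" using A(1) by measurable
    fix x assume "x \<in> Om"
    with A(2)[OF this] pos[OF this] k_min_pos show "\<bar>1 / A x\<bar> \<le> 1 / k_min"
      by (auto intro!: divide_left_mono)
  qed
  have invL2: "(\<lambda>x. 1 / A x) \<in> L2 Om" using inv by (rule bounded_L2)
  have F: "prim f \<in> borel_measurable M" "prim f \<in> L2 Om" "\<And>x. x \<in> Om \<Longrightarrow> \<bar>prim f x\<bar> \<le> sqrt L * L2norm Om f"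
    using f_L2 by (auto intro: prim_measurable prim_L2 prim_bound)
  define i where "i = (LINT x|M. 1 / A x)"
  have "0 < i"
  proof -
    \<comment> \<open>The upper bound on A keeps 1 / A away from zero, so that dividing by
      \<open>i\<close> is legitimate.\<close>
    have "(LINT x|M. 1 / k_max) \<le> i"
      unfolding i_def
    proof (rule integral_mono)
      show "integrable M (\<lambda>x. 1 / A x)" by (rule L2_integrable[OF invL2])
      fix x assume "x \<in> space M"
      with A(2)[of x] pos[of x] show "1 / k_max \<le> 1 / A x"
        by (auto intro!: divide_left_mono)
    qed simp
    moreover have "0 < (LINT x|M. 1 / k_max)"
      using k_max_pos L_pos by (simp add: measure_M)
    ultimately show ?thesis by linarith
  qed
  define c where "c = (LINT x|M. 1 / A x * prim f x) / i"
  define g where "g x = (c - prim f x) / A x" for x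
  have gmeas: "g \<in> borel_measurable M"
    unfolding g_def using A(1) F(1) by measurable
  \<comment> \<open>\<open>prim_H10\<close> asks for a bounded derivative. The bound combines the
    pointwise bound of \<open>prim f\<close> with the lower bound of A.\<close>
  have gbound: "\<bar>g x\<bar> \<le> (\<bar>c\<bar> + sqrt L * L2norm Om f) * (1 / k_min)" if "x \<in> Om" for x
  proof -
    have "\<bar>g x\<bar> = \<bar>c - prim f x\<bar> * \<bar>1 / A x\<bar>" by (simp add: g_def abs_mult)
    also have "\<dots> \<le> (\<bar>c\<bar> + sqrt L * L2norm Om f) * (1 / k_min)"
      using F(3)[OF that] inv(2)[OF that] by (intro mult_mono) auto
    finally show ?thesis .
  qed
  have gL2: "g \<in> L2 Om" using gmeas gbound by (rule bounded_L2)
  have "(LINT x|M. g x) = (LINT x|M. c * (1 / A x) - 1 / A x * prim f x)"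
    by (intro Bochner_Integration.integral_cong) (auto simp: g_def diff_divide_distrib)
  also have "\<dots> = c * i - (LINT x|M. 1 / A x * prim f x)"
    unfolding i_def
    by (subst Bochner_Integration.integral_diff[OF integrable_mult_right[OF L2_integrable[OF invL2]]
          L2_mult_integrable[OF invL2 F(2)]])
      (simp only: integral_mult_right_zero)
  also have "\<dots> = 0" using \<open>0 < i\<close> by (simp add: c_def)
  finally have g0: "(LINT x|M. g x) = 0" .
  have "(LINT x|M. A x * g x * weak_deriv Om v x) = form_l L f v" if v: "v \<in> H10 Om" for v
  proof -
    let ?d = "weak_deriv Om v"
    have d: "?d \<in> L2 Om" by (rule H10_weak_deriv_L2[OF v])
    have "(LINT x|M. A x * g x * ?d x) = (LINT x|M. c * ?d x - prim f x * ?d x)"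
    proof (rule Bochner_Integration.integral_cong)
      fix x assume "x \<in> space M"
      then have "A x \<noteq> 0" using pos[of x] by simp
      then show "A x * g x * ?d x = c * ?d x - prim f x * ?d x"
        by (simp add: g_def left_diff_distrib)
    qed simp
    \<comment> \<open>The constant c drops out because weak derivatives in \<open>H10\<close> have
      mean zero; integration by parts then turns \<open>prim f\<close> back into f.\<close>
    also have "\<dots> = - (LINT x|M. prim f x * ?d x)"
      using d F(2) H10_prim_representation(2)[OF v] by (simp add: L2_integrable L2_mult_integrable)
    also have "\<dots> = (LINT x|M. f x * prim ?d x)"
      using integral_prim_mult[OF f_L2 d H10_prim_representation(2)[OF v]] by simp
    also have "\<dots> = form_l L f v"
      unfolding form_l_def
    proof (rule integral_cong_AE)
      show "AE x in M. f x * prim ?d x = f x * v x"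
        using H10_prim_representation(1)[OF v] by eventually_elim simp
    qed (intro borel_measurable_times L2_measurable[OF f_L2] prim_measurable d L2_measurable[OF H10_L2[OF v]])+
    finally show ?thesis .
  qed
  then show ?thesis
    using that[OF gL2 prim_H10[OF gmeas gbound g0]] by blast
qed

end

section \<open>Strong convergence of Galerkin approximations\<close>

context quasilinear
begin

text \<open>G fixes the limit coefficient before it is known to satisfy any equation. In the
  comparison with the solution of the resulting linear problem, one error term carries the uniformly
  small difference of the coefficients, the other the approximation error of the spaces. Uniqueness
  of limits identifies G afterwards.\<close>

theorem galerkin_strong_subsequence:
  fixes U :: "nat \<Rightarrow> real \<Rightarrow> real" and V :: "nat \<Rightarrow> (real \<Rightarrow> real) set"
    and J :: "nat \<Rightarrow> (real \<Rightarrow> real) \<Rightarrow> real \<Rightarrow> real"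
  assumes V: "\<And>n. V n \<subseteq> H10 Om" "\<And>n v w. v \<in> V n \<Longrightarrow> w \<in> V n \<Longrightarrow> (\<lambda>x. v x - w x) \<in> V n"
    and J: "\<And>n v. v \<in> H10 Om \<Longrightarrow> J n v \<in> V n"
    and J_lim: "\<And>v. v \<in> H10 Om \<Longrightarrow> (\<lambda>n. H1_norm Om (\<lambda>x. J n v x - v x)) \<longlonglongrightarrow> 0"
    and U: "\<And>n. U n \<in> V n"
    and galerkin: "\<And>n v. v \<in> V n \<Longrightarrow> form (U n) (U n) v = form_l L f v"
  obtains k u where "strict_mono (k :: nat \<Rightarrow> nat)" "u \<in> H10 Om"
    and "(\<lambda>n. H1_norm Om (\<lambda>x. U (k n) x - u x)) \<longlonglongrightarrow> 0"
    and "\<And>w. w \<in> H10 Om \<Longrightarrow> form u u w = form_l L f w"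
proof -
  have UH: "U n \<in> H10 Om" for n using U V(1) by blast
  define D where "D n = weak_deriv Om (U n)" for n
  define R where "R = L2norm Om f * L / k_min"
  have D: "D n \<in> L2 Om" for n unfolding D_def by (rule H10_weak_deriv_L2[OF UH])
  have DR: "L2norm Om (D n) \<le> R" for n
    unfolding D_def R_def by (rule galerkin_bound[OF UH galerkin[OF U]])
  obtain G k where G: "continuous_on {0..L} G" and k: "strict_mono (k :: nat \<Rightarrow> nat)"
    and unif: "\<And>e. 0 < e \<Longrightarrow> \<forall>\<^sub>F n in sequentially. \<forall>x\<in>{0..L}. \<bar>prim (D (k n)) x - G x\<bar> < e"
    by (rule prim_subseq_uniform_limit[of D R, OF D DR]) (rule that)
  define A where "A x = K x (G x)" for x
  have A: "A \<in> borel_measurable M" "\<And>x. x \<in> Om \<Longrightarrow> A x \<in> {k_min..k_max}"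
    unfolding A_def using K_measurable[OF G] K_range by auto
  have A_abs: "\<bar>A x\<bar> \<le> k_max" if "x \<in> Om" for x
    unfolding A_def using K_abs[OF that] .
  obtain g where g: "g \<in> L2 Om" and w: "prim g \<in> H10 Om" and Dw: "AE x in M. weak_deriv Om (prim g) x = g x"
    and weak: "\<And>v. v \<in> H10 Om \<Longrightarrow> (LINT x|M. A x * g x * weak_deriv Om v x) = form_l L f v"
    using linear_problem_solution[OF A] by blast
  define An where "An n x = K x (prim (D (k n)) x)" for n x
  have An: "An n \<in> borel_measurable M" "\<And>x. x \<in> Om \<Longrightarrow> \<bar>An n x\<bar> \<le> k_max"
    "\<And>x. x \<in> Om \<Longrightarrow> k_min \<le> An n x" for n
    unfolding An_def using K_prim_measurable[OF D] K_abs K_range by auto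
  \<comment> \<open>The competitor of Cea's lemma: an approximation, inside the Galerkin space, of
    the expected limit.\<close>
  define W where "W n = J (k n) (prim g)" for n
  have WV: "W n \<in> V (k n)" for n unfolding W_def by (rule J[OF w])
  have WH: "W n \<in> H10 Om" for n using WV V(1) by blast
  \<comment> \<open>\<open>e\<close> is the derivative error of the Galerkin solution and
    \<open>d\<close> that of the competitor; e - d is almost everywhere the weak derivative of their
    difference, an admissible test function.\<close>
  define e where "e n x = D (k n) x - g x" for n x
  define d where "d n x = weak_deriv Om (W n) x - g x" for n x
  have e: "e n \<in> L2 Om" for n unfolding e_def by (intro L2_diff D g)
  have d: "d n \<in> L2 Om" for n unfolding d_def by (intro L2_diff H10_weak_deriv_L2 WH g)
  define R' where "R' = R + L2norm Om g"
  have eR: "L2norm Om (e n) \<le> R'" for n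
    using L2norm_triangle_diff[OF D g, of "k n"] DR[of "k n"] by (simp add: e_def[abs_def] R'_def)
  have R'0: "0 \<le> R'" using eR[of 0] L2norm_nonneg[of Om "e 0"] by linarith
  have d_lim: "(\<lambda>n. L2norm Om (d n)) \<longlonglongrightarrow> 0"
  proof (rule Lim_null_comparison)
    show "(\<lambda>n. H1_norm Om (\<lambda>x. W n x - prim g x)) \<longlonglongrightarrow> 0"
      using LIMSEQ_subseq_LIMSEQ[OF J_lim[OF w] k] by (simp add: W_def o_def)
    have "L2norm Om (d n) \<le> H1_norm Om (\<lambda>x. W n x - prim g x)" for n
    proof -
      have WH1: "W n \<in> H1 Om" "prim g \<in> H1 Om" using WH w H10_H1 by auto
      have "L2norm Om (d n) = L2norm Om (weak_deriv Om (\<lambda>x. W n x - prim g x))"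
      proof (rule L2norm_cong_AE)
        show "AE x in M. d n x = weak_deriv Om (\<lambda>x. W n x - prim g x) x"
          using H1_diff(2)[OF WH1] Dw by eventually_elim (simp add: d_def)
      qed (intro L2_measurable d H10_weak_deriv_L2 H10_diff WH w)+
      also have "\<dots> \<le> H1_norm Om (\<lambda>x. W n x - prim g x)"
        by (rule L2norm_weak_deriv_le_H1_norm)
      finally show ?thesis .
    qed
    then show "\<forall>\<^sub>F n in sequentially. norm (L2norm Om (d n)) \<le> H1_norm Om (\<lambda>x. W n x - prim g x)"
      by simp
  qed

  text \<open>Both \<open>U (k n)\<close> and \<open>prim g\<close> satisfy their equations for the test function
    \<open>U (k n) - W n\<close>, so only the difference of the two coefficients remains.\<close>
  have orth: "(LINT x|M. An n x * D (k n) x * (e n x - d n x)) = (LINT x|M. A x * g x * (e n x - d n x))" for n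
  proof -
    let ?v = "\<lambda>x. U (k n) x - W n x"
    have v: "?v \<in> V (k n)" by (rule V(2)[OF U WV])
    then have vH: "?v \<in> H10 Om" using V(1) by blast
    have ae: "AE x in M. weak_deriv Om ?v x = e n x - d n x"
      using H1_diff(2)[OF H10_H1[OF UH] H10_H1[OF WH], of "k n" n]
      by eventually_elim (simp add: e_def d_def D_def)
    have cong: "(LINT x|M. b x * h x * weak_deriv Om ?v x) = (LINT x|M. b x * h x * (e n x - d n x))"
      if "b \<in> borel_measurable M" "h \<in> L2 Om" for b h
    proof (rule integral_cong_AE)
      show "AE x in M. b x * h x * weak_deriv Om ?v x = b x * h x * (e n x - d n x)"
        using ae by eventually_elim simp
    qed (intro borel_measurable_times that L2_measurable[OF that(2)] L2_measurable[OF H10_weak_deriv_L2[OF vH]]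
        L2_measurable[OF L2_diff[OF e d]])+
    have "(LINT x|M. An n x * D (k n) x * (e n x - d n x)) = form (U (k n)) (U (k n)) ?v"
      by (simp add: form_prim[OF UH UH vH] An_def cong[symmetric, OF An(1)[unfolded An_def] D] flip: D_def)
    also have "\<dots> = (LINT x|M. A x * g x * weak_deriv Om ?v x)"
      using galerkin[OF v] weak[OF vH] by simp
    also have "\<dots> = (LINT x|M. A x * g x * (e n x - d n x))"
      by (rule cong[OF A(1) g])
    finally show ?thesis .
  qed
  have main: "k_min * (L2norm Om (e n))\<^sup>2 \<le>
      \<epsilon> * L2norm Om g * (R' + L2norm Om (d n)) + k_max * R' * L2norm Om (d n)"
    if \<epsilon>: "\<And>x. x \<in> Om \<Longrightarrow> \<bar>A x - An n x\<bar> \<le> \<epsilon>" for n \<epsilon>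
  proof -
    have \<epsilon>0: "0 \<le> \<epsilon>" using \<epsilon>[of "L / 2"] L_pos by simp
    note ed = L2_diff[OF e d, of n n]
    have int: "integrable M (\<lambda>x. An n x * p x * q x)" if "p \<in> L2 Om" "q \<in> L2 Om" for p q
      using that by (intro weighted_integrable[OF An(1,2)])
    \<comment> \<open>Splits one factor e into (e - d) + d and, in the product with e - d, the other
      into D - g, so that \<open>orth\<close> applies to the term with D.\<close>
    have "(LINT x|M. An n x * e n x * e n x)
        = (LINT x|M. An n x * D (k n) x * (e n x - d n x) - An n x * g x * (e n x - d n x) + An n x * e n x * d n x)"
      by (intro Bochner_Integration.integral_cong) (auto simp: e_def algebra_simps)
    also have "\<dots> = (LINT x|M. An n x * D (k n) x * (e n x - d n x))
        - (LINT x|M. An n x * g x * (e n x - d n x)) + (LINT x|M. An n x * e n x * d n x)"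
      by (simp add: int ed D g e d)
    also have "\<dots> = (LINT x|M. A x * g x * (e n x - d n x))
        - (LINT x|M. An n x * g x * (e n x - d n x)) + (LINT x|M. An n x * e n x * d n x)"
      by (simp only: orth)
    also have "\<dots> = (LINT x|M. (A x - An n x) * g x * (e n x - d n x)) + (LINT x|M. An n x * e n x * d n x)"
      using weighted_integrable[OF A(1) A_abs g ed] int[OF g ed]
      by (simp add: left_diff_distrib)
    finally have "k_min * (L2norm Om (e n))\<^sup>2 \<le> \<dots>"
      using weighted_integral_coercive[OF An(1,2,3) e, of n n] by simp
    also have "\<dots> \<le> \<epsilon> * L2norm Om g * L2norm Om (\<lambda>x. e n x - d n x) + k_max * L2norm Om (e n) * L2norm Om (d n)"
    proof (rule add_mono)
      have "(\<lambda>x. A x - An n x) \<in> borel_measurable M"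
        using A(1) An(1) by measurable
      then show "(LINT x|M. (A x - An n x) * g x * (e n x - d n x))
          \<le> \<epsilon> * L2norm Om g * L2norm Om (\<lambda>x. e n x - d n x)"
        by (rule order_trans[OF abs_ge_self weighted_integral_bound[OF _ \<epsilon> g ed]])
      show "(LINT x|M. An n x * e n x * d n x) \<le> k_max * L2norm Om (e n) * L2norm Om (d n)"
        by (rule order_trans[OF abs_ge_self weighted_integral_bound[OF An(1,2) e d]])
    qed
    also have "\<dots> \<le> \<epsilon> * L2norm Om g * (R' + L2norm Om (d n)) + k_max * R' * L2norm Om (d n)"
      using L2norm_triangle_diff[OF e d, of n n] eR[of n] k_max_pos \<epsilon>0
      by (intro add_mono mult_left_mono mult_right_mono) auto
    finally show ?thesis .
  qed
  have e_lim: "(\<lambda>n. L2norm Om (e n)) \<longlonglongrightarrow> 0"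
  proof (rule LIMSEQ_I)
    fix r :: real assume "0 < r"
    \<comment> \<open>For \<epsilon> \<le> 1 and a competitor error below \<epsilon>, the right-hand
      side of \<open>main\<close> is at most \<epsilon> (Q - 1). The summand 1 makes Q positive and
      the final inequality strict; the minimum with 1 in \<epsilon> justifies the factor R' +
      1.\<close>
    define Q where "Q = L2norm Om g * (R' + 1) + k_max * R' + 1"
    have Q: "0 < Q"
      unfolding Q_def using R'0 k_max_pos by (intro add_nonneg_pos add_nonneg_nonneg mult_nonneg_nonneg) auto
    define \<epsilon> where "\<epsilon> = min 1 (k_min * r\<^sup>2 / Q)"
    have \<epsilon>: "0 < \<epsilon>" "\<epsilon> \<le> 1" "\<epsilon> * Q \<le> k_min * r\<^sup>2"
      unfolding \<epsilon>_def using Q \<open>0 < r\<close> k_min_pos by (auto simp: min_def field_simps)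
    have "\<forall>\<^sub>F n in sequentially. L2norm Om (d n) < \<epsilon>"
      using order_tendstoD(2)[OF d_lim \<epsilon>(1)] .
    \<comment> \<open>The Lipschitz condition turns this tolerance into a coefficient error of at
      most \<epsilon>; the denominator is positive whatever C is.\<close>
    moreover have "\<forall>\<^sub>F n in sequentially. \<forall>x\<in>{0..L}. \<bar>prim (D (k n)) x - G x\<bar> < \<epsilon> / (\<bar>C\<bar> + 1)"
      using \<epsilon>(1) by (intro unif) simp
    ultimately have "\<forall>\<^sub>F n in sequentially. L2norm Om (e n) < r"
    proof eventually_elim
      case (elim n)
      have "\<bar>A x - An n x\<bar> \<le> \<epsilon>" if "x \<in> Om" for x
      proof -
        have "\<bar>A x - An n x\<bar> \<le> C * \<bar>G x - prim (D (k n)) x\<bar>"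
          unfolding A_def An_def by (rule K_lipschitz[OF that])
        also have "\<dots> \<le> (\<bar>C\<bar> + 1) * \<bar>G x - prim (D (k n)) x\<bar>"
          by (intro mult_right_mono) auto
        also have "\<dots> \<le> (\<bar>C\<bar> + 1) * (\<epsilon> / (\<bar>C\<bar> + 1))"
          using elim(2) that by (intro mult_left_mono) (auto simp: abs_minus_commute less_imp_le)
        also have "\<dots> = \<epsilon>" by simp
        finally show ?thesis .
      qed
      then have "k_min * (L2norm Om (e n))\<^sup>2
          \<le> \<epsilon> * L2norm Om g * (R' + L2norm Om (d n)) + k_max * R' * L2norm Om (d n)"
        by (rule main)
      also have "\<dots> \<le> \<epsilon> * L2norm Om g * (R' + 1) + k_max * R' * \<epsilon>"
        using elim(1) \<epsilon> R'0 k_max_pos by (intro add_mono mult_left_mono) auto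
      also have "\<dots> < \<epsilon> * Q"
        using \<epsilon>(1) by (simp add: Q_def algebra_simps)
      also have "\<dots> \<le> k_min * r\<^sup>2" by (rule \<epsilon>(3))
      finally have "(L2norm Om (e n))\<^sup>2 < r\<^sup>2"
        using k_min_pos by simp
      then show ?case
        using \<open>0 < r\<close> by (simp add: power2_less_imp_less)
    qed
    then show "\<exists>no. \<forall>n\<ge>no. norm (L2norm Om (e n) - 0) < r"
      by (simp add: eventually_sequentially)
  qed
  have strong: "(\<lambda>n. H1_norm Om (\<lambda>x. U (k n) x - prim g x)) \<longlonglongrightarrow> 0"
  proof (rule Lim_null_comparison)
    show "(\<lambda>n. (L + 1) * L2norm Om (e n)) \<longlonglongrightarrow> 0"
      using e_lim by (rule tendsto_mult_right_zero)
    have "H1_norm Om (\<lambda>x. U (k n) x - prim g x) \<le> (L + 1) * L2norm Om (e n)" for n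
    proof -
      let ?v = "\<lambda>x. U (k n) x - prim g x"
      have v: "?v \<in> H10 Om" by (intro H10_diff UH w)
      have "L2norm Om (weak_deriv Om ?v) = L2norm Om (e n)"
      proof (rule L2norm_cong_AE)
        show "AE x in M. weak_deriv Om ?v x = e n x"
          using H1_diff(2)[OF H10_H1[OF UH] H10_H1[OF w], of "k n"] Dw
          by eventually_elim (simp add: e_def D_def)
      qed (intro L2_measurable H10_weak_deriv_L2 v e)+
      \<comment> \<open>The error is itself almost everywhere the primitive of \<open>e n\<close>,
        so the Poincare inequality bounds it by the derivative error.\<close>
      moreover have "L2norm Om ?v = L2norm Om (prim (e n))"
      proof (rule L2norm_cong_AE)
        show "AE x in M. ?v x = prim (e n) x"
          using H10_prim_representation(1)[OF UH, of "k n"]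
          by eventually_elim (simp add: e_def[abs_def] prim_diff[OF D g] flip: D_def)
      qed (intro L2_measurable[OF H10_L2[OF v]] prim_measurable e)+
      ultimately show ?thesis
        using H1_norm_le_add[of ?v] prim_L2norm_le[OF e, of n] by (simp add: algebra_simps)
    qed
    then show "\<forall>\<^sub>F n in sequentially. norm (H1_norm Om (\<lambda>x. U (k n) x - prim g x)) \<le> (L + 1) * L2norm Om (e n)"
      by (simp add: H1_norm_alt)
  qed
  have G_eq: "G x = prim g x" if x: "x \<in> Om" for x
  proof (rule LIMSEQ_unique)
    show "(\<lambda>n. prim (D (k n)) x) \<longlonglongrightarrow> G x"
    proof (rule tendstoI)
      fix r :: real assume "0 < r"
      from unif[OF this] show "\<forall>\<^sub>F n in sequentially. dist (prim (D (k n)) x) (G x) < r"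
        by eventually_elim (use x in \<open>auto simp: dist_real_def\<close>)
    qed
    have "(\<lambda>n. prim (D (k n)) x - prim g x) \<longlonglongrightarrow> 0"
    proof (rule Lim_null_comparison)
      show "(\<lambda>n. sqrt L * L2norm Om (e n)) \<longlonglongrightarrow> 0"
        using e_lim by (rule tendsto_mult_right_zero)
      show "\<forall>\<^sub>F n in sequentially. norm (prim (D (k n)) x - prim g x) \<le> sqrt L * L2norm Om (e n)"
        using prim_bound[OF e x] by (simp add: e_def[abs_def] prim_diff[OF D g])
    qed
    then show "(\<lambda>n. prim (D (k n)) x) \<longlonglongrightarrow> prim g x"
      by (rule LIM_zero_cancel)
  qed
  have "form (prim g) (prim g) v = form_l L f v" if v: "v \<in> H10 Om" for v
  proof -
    have "form (prim g) (prim g) v = (LINT x|M. A x * g x * weak_deriv Om v x)"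
      unfolding form_def
    proof (rule integral_cong_AE)
      have "AE x in M. x \<in> Om" by (rule AE_I2) simp
      with Dw show "AE x in M. K x (prim g x) * weak_deriv Om (prim g) x * weak_deriv Om v x =
          A x * g x * weak_deriv Om v x"
        by eventually_elim (simp add: A_def G_eq del: greaterThanLessThan_iff)
    qed (intro borel_measurable_times K_prim_measurable g A(1) L2_measurable[OF g]
        L2_measurable[OF H10_weak_deriv_L2] v w)+
    then show ?thesis using weak[OF v] by simp
  qed
  with k w strong show ?thesis by (rule that)
qed

end

section \<open>Piecewise coefficients\<close>

text \<open>Each choice stays below the previous element and below 1/(n+1) at position n. Strict
  decrease is inherited by every subsequence.\<close>

lemma decreasing_sequence_to_islimpt:
  fixes H :: "real set"
  assumes "H \<subseteq> {0<..}" "0 islimpt H"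
  obtains h where "\<And>n. h n \<in> H" "\<And>n :: nat. h (Suc n) < h n" "h \<longlonglongrightarrow> 0"
proof -
  have ex: "\<exists>x\<in>H. x < e" if e: "0 < e" for e
  proof -
    obtain x where "x \<in> H" "dist x 0 < e"
      using assms(2) e by (auto simp: islimpt_approachable)
    then show ?thesis by (intro bexI[of _ x]) (auto simp: dist_real_def)
  qed
  have "\<exists>h. \<forall>n. (h n \<in> H \<and> h n < inverse (real (Suc n))) \<and> h (Suc n) < h n"
  proof (rule dependent_nat_choice)
    show "\<exists>x. x \<in> H \<and> x < inverse (real (Suc 0))"
      using ex[of 1] by auto
    fix x n assume "x \<in> H \<and> x < inverse (real (Suc n))"
    then have "0 < min x (inverse (real (Suc (Suc n))))"
      using assms(1) by auto
    then show "\<exists>y. (y \<in> H \<and> y < inverse (real (Suc (Suc n)))) \<and> y < x"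
      using ex[of "min x (inverse (real (Suc (Suc n))))"] by auto
  qed
  then obtain h where h: "\<And>n. h n \<in> H" "\<And>n. h n < inverse (real (Suc n))" "\<And>n. h (Suc n) < h n"
    by blast
  have "h \<longlonglongrightarrow> 0"
  proof (rule Lim_null_comparison[OF _ LIMSEQ_inverse_real_of_nat])
    have "norm (h n) \<le> inverse (real (Suc n))" for n
      using h(1,2)[of n] assms(1) by (auto simp: less_imp_le)
    then show "\<forall>\<^sub>F n in sequentially. norm (h n) \<le> inverse (real (Suc n))" by simp
  qed
  with h show ?thesis using that by blast
qed

locale interfaces = interval +
  fixes m :: nat and \<gamma> :: "nat \<Rightarrow> real"
  assumes \<gamma>_mono: "strict_mono_on {1..m} \<gamma>"
    and \<gamma>_mem: "\<And>j. j \<in> {1..m} \<Longrightarrow> \<gamma> j \<in> {0<..<L}"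
begin

lemma node_less:
  assumes "i < j" "j \<le> Suc m"
  shows "node L m \<gamma> i < node L m \<gamma> j"
proof -
  have "\<gamma> i < \<gamma> j" if "0 < i" "j \<le> m"
    using that assms(1) by (intro strict_mono_onD[OF \<gamma>_mono]) auto
  then show ?thesis
    using assms L_pos \<gamma>_mem[of i] \<gamma>_mem[of j] by (auto simp: node_def)
qed

lemma node_le: "i \<le> j \<Longrightarrow> j \<le> Suc m \<Longrightarrow> node L m \<gamma> i \<le> node L m \<gamma> j"
  using node_less[of i j] by (cases "i = j") auto

lemma subdomain_subset: "j \<le> m \<Longrightarrow> subdomain L m \<gamma> j \<subseteq> Om"
  using node_le[of 0 j] node_le[of "Suc j" "Suc m"] by (auto simp: subdomain_def node_def[of _ _ _ 0] node_def[of _ _ _ "Suc m"])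

lemma subdomain_disjoint:
  assumes "x \<in> subdomain L m \<gamma> i" "x \<in> subdomain L m \<gamma> j" "i \<le> m" "j \<le> m"
  shows "i = j"
proof (rule ccontr)
  assume "i \<noteq> j"
  then consider "Suc i \<le> j" | "Suc j \<le> i" by linarith
  then show False
    using assms node_le[of "Suc i" j] node_le[of "Suc j" i]
    by cases (auto simp: subdomain_def)
qed

text \<open>Only the countably many nodes are missed. Away from them, induction on the index of a
  node finds the piece containing a point to its left.\<close>

lemma AE_subdomain: "AE x in M. \<exists>j\<le>m. x \<in> subdomain L m \<gamma> j"
proof -
  have cover: "\<exists>j<n. x \<in> subdomain L m \<gamma> j"
    if "0 < x" "x < node L m \<gamma> n" "x \<notin> range (node L m \<gamma>)" for x n
    using that(2)
  proof (induction n)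
    case 0
    with that(1) show ?case by (simp add: node_def)
  next
    case (Suc n)
    show ?case
    proof (cases "x < node L m \<gamma> n")
      case True
      with Suc.IH show ?thesis using less_Suc_eq by blast
    next
      case False
      moreover have "x \<noteq> node L m \<gamma> n" using that(3) by blast
      ultimately show ?thesis using Suc.prems by (intro exI[of _ n]) (auto simp: subdomain_def)
    qed
  qed
  have "countable (range (node L m \<gamma>))" by simp
  then have "AE x in lebesgue. x \<notin> range (node L m \<gamma>)"
    by (intro AE_not_in null_sets_completionI countable_imp_null_set_lborel)
  then have "AE x in lebesgue. x \<in> Om \<longrightarrow> (\<exists>j\<le>m. x \<in> subdomain L m \<gamma> j)"
  proof eventually_elim
    case (elim x)
    then show ?case
      using cover[of x "Suc m"] by (auto simp: node_def[of _ _ _ "Suc m"] less_Suc_eq_le)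
  qed
  then show ?thesis by (subst AE_restrict_space_iff) auto
qed

text \<open>The global coefficient. Its values at the interfaces are irrelevant, but the constant there
  keeps its bounds and its Lipschitz condition valid everywhere in \<open>Om\<close>.\<close>

definition coefficient :: "real \<Rightarrow> (nat \<Rightarrow> real \<Rightarrow> real \<Rightarrow> real) \<Rightarrow> real \<Rightarrow> real \<Rightarrow> real" where
  "coefficient c \<kappa> x \<zeta> = (if \<exists>j\<le>m. x \<in> subdomain L m \<gamma> j
     then \<kappa> (THE j. j \<le> m \<and> x \<in> subdomain L m \<gamma> j) x \<zeta> else c)"

lemma coefficient_eq:
  assumes "j \<le> m" "x \<in> subdomain L m \<gamma> j"
  shows "coefficient c \<kappa> x \<zeta> = \<kappa> j x \<zeta>"
proof -
  have "(THE j. j \<le> m \<and> x \<in> subdomain L m \<gamma> j) = j"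
    using assms subdomain_disjoint by (intro the_equality) auto
  with assms show ?thesis by (auto simp: coefficient_def)
qed

lemma sum_indicator_subdomain:
  assumes "j \<le> m" "x \<in> subdomain L m \<gamma> j"
  shows "(\<Sum>i=0..m. indicat_real (subdomain L m \<gamma> i) x) = 1"
proof -
  have "(\<Sum>i=0..m. indicat_real (subdomain L m \<gamma> i) x) = (\<Sum>i=0..m. if i = j then 1 else 0)"
    using assms subdomain_disjoint by (intro sum.cong) (auto simp: indicator_def)
  with assms(1) show ?thesis by simp
qed

text \<open>On each piece the composition with v is continuous. The pieces, extended by zero, add up
  to the global coefficient off the nodes, and completeness of the measure covers the nodes.\<close>

lemma coefficient_measurable:
  assumes \<kappa>: "\<And>j. j \<le> m \<Longrightarrow>
      continuous_on (closure (subdomain L m \<gamma> j) \<times> UNIV) (\<lambda>(x, \<zeta>). \<kappa> j x \<zeta>)"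
    and v: "continuous_on {0..L} v"
  shows "(\<lambda>x. coefficient c \<kappa> x (v x)) \<in> borel_measurable M"
proof (rule borel_measurable_cong_AE)
  let ?S = "subdomain L m \<gamma>"
  show "(\<lambda>x. \<Sum>j=0..m. if x \<in> ?S j then \<kappa> j x (v x) else 0) \<in> borel_measurable M"
  proof (rule borel_measurable_sum)
    fix j assume "j \<in> {0..m}"
    then have j: "j \<le> m" by simp
    have "?S j \<subseteq> {0..L}" using subdomain_subset[OF j] by auto
    then have "continuous_on (?S j) (\<lambda>x. (x, v x))"
      by (intro continuous_intros continuous_on_subset[OF v])
    then have "continuous_on (?S j) (\<lambda>x. (\<lambda>(x, \<zeta>). \<kappa> j x \<zeta>) (x, v x))"
      by (rule continuous_on_compose2[OF \<kappa>[OF j]]) (use closure_subset in auto)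
    then have "(\<lambda>x. \<kappa> j x (v x)) \<in> borel_measurable (lebesgue_on (?S j))"
      by (intro continuous_imp_measurable_on_sets_lebesgue) (auto simp: subdomain_def)
    then show "(\<lambda>x. if x \<in> ?S j then \<kappa> j x (v x) else 0) \<in> borel_measurable M"
      using subdomain_subset[OF j]
      by (subst borel_measurable_if_lebesgue_on) (auto simp: subdomain_def)
  qed
  show "AE x in M. (\<Sum>j=0..m. if x \<in> ?S j then \<kappa> j x (v x) else 0) = coefficient c \<kappa> x (v x)"
    using AE_subdomain
  proof eventually_elim
    case (elim x)
    then obtain j where j: "j \<le> m" "x \<in> ?S j" by blast
    have "(\<Sum>i=0..m. if x \<in> ?S i then \<kappa> i x (v x) else 0)
        = (\<Sum>i=0..m. indicat_real (?S i) x * coefficient c \<kappa> x (v x))"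
      by (intro sum.cong) (auto simp: indicator_def coefficient_eq)
    also have "\<dots> = coefficient c \<kappa> x (v x)"
      by (simp add: sum_indicator_subdomain[OF j] flip: sum_distrib_right)
    finally show ?case .
  qed
qed

text \<open>Reduces the piecewise form to the single integral of the locale
  \<open>quasilinear\<close>. The bound makes every localized integrand integrable, which lets sum
  and integral be exchanged; off the nodes the indicators add up to 1.\<close>

lemma form_a_eq_integral:
  assumes a: "(\<lambda>x. coefficient c \<kappa> x (v x)) \<in> borel_measurable M"
    and bound: "\<And>x. x \<in> Om \<Longrightarrow> \<bar>coefficient c \<kappa> x (v x)\<bar> \<le> k"
    and u: "weak_deriv Om u \<in> L2 Om" and w: "weak_deriv Om w \<in> L2 Om"
  shows "form_a L m \<gamma> \<kappa> v u w = (LINT x|M. coefficient c \<kappa> x (v x) * weak_deriv Om u x * weak_deriv Om w x)"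
proof -
  let ?S = "subdomain L m \<gamma>"
  let ?K = "\<lambda>x. coefficient c \<kappa> x (v x)"
  let ?h = "\<lambda>j x. indicat_real (?S j) x * ?K x * weak_deriv Om u x * weak_deriv Om w x"
  have int: "integrable M (?h j)" if "j \<le> m" for j
  proof (rule weighted_integrable[OF _ _ u w, where k=k])
    show "(\<lambda>x. indicat_real (?S j) x * ?K x) \<in> borel_measurable M"
      by (intro borel_measurable_times a L2_measurable[OF indicator_L2]) (simp add: subdomain_def)
    show "\<bar>indicat_real (?S j) x * ?K x\<bar> \<le> k" if "x \<in> Om" for x
      using bound[OF that] by (auto simp: indicator_def)
  qed
  have "form_a L m \<gamma> \<kappa> v u w = (\<Sum>j=0..m. LINT x|M. ?h j x)"
    unfolding form_a_def
  proof (rule sum.cong)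
    fix j assume "j \<in> {0..m}"
    then have j: "j \<le> m" by simp
    have "(LINT x|lebesgue_on (?S j). \<kappa> j x (v x) * weak_deriv Om u x * weak_deriv Om w x)
      = (LINT x|M. (if x \<in> ?S j then \<kappa> j x (v x) * weak_deriv Om u x * weak_deriv Om w x else 0))"
      using subdomain_subset[OF j] by (intro integral_restrict[symmetric]) (auto simp: subdomain_def)
    also have "\<dots> = (LINT x|M. ?h j x)"
      by (intro Bochner_Integration.integral_cong) (auto simp: coefficient_eq[OF j])
    finally show "(LINT x|lebesgue_on (?S j). \<kappa> j x (v x) * weak_deriv Om u x * weak_deriv Om w x) = (LINT x|M. ?h j x)" .
  qed simp
  also have "\<dots> = (LINT x|M. (\<Sum>j=0..m. ?h j x))"
    using int by (intro Bochner_Integration.integral_sum[symmetric]) auto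
  also have "\<dots> = (LINT x|M. ?K x * weak_deriv Om u x * weak_deriv Om w x)"
  proof (rule integral_cong_AE)
    show "AE x in M. (\<Sum>j=0..m. ?h j x) = ?K x * weak_deriv Om u x * weak_deriv Om w x"
      using AE_subdomain
    proof eventually_elim
      case (elim x)
      then obtain j where "j \<le> m" "x \<in> ?S j" by blast
      from sum_indicator_subdomain[OF this] show ?case
        by (simp flip: sum_distrib_right)
    qed
    show "(\<lambda>x. \<Sum>j=0..m. ?h j x) \<in> borel_measurable M"
      using int by (intro borel_measurable_sum borel_measurable_integrable) auto
    show "(\<lambda>x. ?K x * weak_deriv Om u x * weak_deriv Om w x) \<in> borel_measurable M"
      by (intro borel_measurable_times a L2_measurable u w)
  qed
  finally show ?thesis .
qed

end

theorem theorem4p2: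
  fixes L :: real and m :: nat and \<gamma> :: "nat \<Rightarrow> real"
    and \<kappa> :: "nat \<Rightarrow> real \<Rightarrow> real \<Rightarrow> real"
    and \<kappa>_min \<kappa>_max C_L :: "nat \<Rightarrow> real"
    and f :: "real \<Rightarrow> real"
    and H :: "real set"
    and V :: "real \<Rightarrow> (real \<Rightarrow> real) set"
    and I :: "real \<Rightarrow> (real \<Rightarrow> real) \<Rightarrow> real \<Rightarrow> real"
    and uh :: "real \<Rightarrow> real \<Rightarrow> real"
  assumes "0 < L"
    and "strict_mono_on {1..m} \<gamma>"
    and "\<And>j. j \<in> {1..m} \<Longrightarrow> \<gamma> j \<in> {0<..<L}"
    and "\<And>j. j \<le> m \<Longrightarrow> 0 < \<kappa>_min j \<and> \<kappa>_min j \<le> \<kappa>_max j"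
    and "\<And>j. j \<le> m \<Longrightarrow>
           continuous_on (closure (subdomain L m \<gamma> j) \<times> UNIV) (\<lambda>(x, \<zeta>). \<kappa> j x \<zeta>)"
    and "\<And>j x \<zeta>. j \<le> m \<Longrightarrow> x \<in> closure (subdomain L m \<gamma> j) \<Longrightarrow>
           \<kappa> j x \<zeta> \<in> {\<kappa>_min j..\<kappa>_max j}"
    and "\<And>j x \<zeta>1 \<zeta>2. j \<le> m \<Longrightarrow> x \<in> subdomain L m \<gamma> j \<Longrightarrow>
           \<bar>\<kappa> j x \<zeta>1 - \<kappa> j x \<zeta>2\<bar> \<le> C_L j * \<bar>\<zeta>1 - \<zeta>2\<bar>"
    and "f \<in> L2 {0<..<L}"
    and "H \<subseteq> {0<..}" and "0 islimpt H"
    and "\<And>h. h \<in> H \<Longrightarrow> findim_subspace_H10 {0<..<L} (V h)"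
    and "\<And>h v. h \<in> H \<Longrightarrow> v \<in> H10 {0<..<L} \<Longrightarrow> I h v \<in> V h"
    and "\<And>v. v \<in> H10 {0<..<L} \<Longrightarrow>
           ((\<lambda>h. H1_norm {0<..<L} (\<lambda>x. I h v x - v x)) \<longlongrightarrow> 0) (at 0 within H)"
    and "\<And>h. h \<in> H \<Longrightarrow> uh h \<in> V h"
    and "\<And>h vh. h \<in> H \<Longrightarrow> vh \<in> V h \<Longrightarrow>
           form_a L m \<gamma> \<kappa> (uh h) (uh h) vh = form_l L f vh"
  shows "\<exists>(hbar :: nat \<Rightarrow> real) u.
           (\<forall>n. hbar n \<in> H) \<and> (\<forall>n. hbar (Suc n) < hbar n) \<and> hbar \<longlonglongrightarrow> 0 \<and>
           u \<in> H10 {0<..<L} \<and>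
           weakly_converges_H10 {0<..<L} (\<lambda>n. uh (hbar n)) u \<and>
           (\<forall>w\<in>H10 {0<..<L}. form_a L m \<gamma> \<kappa> u u w = form_l L f w)"
proof -
  let ?S = "subdomain L m \<gamma>"
  interpret interfaces L m \<gamma>
    by unfold_locales (use assms(1-3) in auto)
  \<comment> \<open>Finitely many pieces admit common constants. The sum of absolute values
    dominates each \<open>C_L j\<close> and is nonnegative, which covers the interfaces, where the
    global coefficient is constant in its second argument.\<close>
  define k_min k_max C where "k_min = Min (\<kappa>_min ` {..m})" and "k_max = Max (\<kappa>_max ` {..m})"
    and "C = (\<Sum>j\<le>m. \<bar>C_L j\<bar>)"
  have k_min: "k_min \<le> \<kappa>_min j" and k_max: "\<kappa>_max j \<le> k_max" and C: "\<bar>C_L j\<bar> \<le> C" if "j \<le> m" for j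
    using that by (auto simp: k_min_def k_max_def C_def intro!: member_le_sum)
  have k_min_pos: "0 < k_min"
    unfolding k_min_def using assms(4) by (subst Min_gr_iff) auto
  have C0: "0 \<le> C" unfolding C_def by (rule sum_nonneg) simp
  define K where "K = coefficient k_min \<kappa>"
  have K_range: "K x z \<in> {k_min..k_max}" for x z
  proof (cases "\<exists>j\<le>m. x \<in> ?S j")
    case True
    then obtain j where j: "j \<le> m" "x \<in> ?S j" by blast
    then have "\<kappa> j x z \<in> {\<kappa>_min j..\<kappa>_max j}"
      using closure_subset by (intro assms(6)) auto
    with k_min[OF j(1)] k_max[OF j(1)] show ?thesis
      by (simp add: K_def coefficient_eq[OF j])
  next
    case False
    moreover have "k_min \<le> k_max"
      using k_min[of 0] k_max[of 0] assms(4)[of 0] by simp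
    ultimately show ?thesis by (auto simp: K_def coefficient_def)
  qed
  interpret quasilinear L K k_min k_max C f
  proof unfold_locales
    show "\<bar>K x y - K x z\<bar> \<le> C * \<bar>y - z\<bar>" for x y z
    proof (cases "\<exists>j\<le>m. x \<in> ?S j")
      case True
      then obtain j where j: "j \<le> m" "x \<in> ?S j" by blast
      have "\<bar>K x y - K x z\<bar> \<le> C_L j * \<bar>y - z\<bar>"
        using assms(7)[OF j] by (simp add: K_def coefficient_eq[OF j])
      also have "\<dots> \<le> C * \<bar>y - z\<bar>"
        using C[OF j(1)] by (intro mult_right_mono) auto
      finally show ?thesis .
    next
      case False
      with C0 show ?thesis by (auto simp: K_def coefficient_def)
    qed
    show "(\<lambda>x. K x (v x)) \<in> borel_measurable M" if "continuous_on {0..L} v" for v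
      unfolding K_def by (rule coefficient_measurable[OF assms(5) that])
  qed (use k_min_pos K_range assms(8) in auto)
  have form: "form_a L m \<gamma> \<kappa> v u w = form v u w" if "v \<in> H10 Om" "u \<in> H10 Om" "w \<in> H10 Om" for v u w
    unfolding form_def
    by (rule form_a_eq_integral[of k_min \<kappa>, folded K_def])
      (use that in \<open>auto intro: K_H10_measurable K_abs H10_weak_deriv_L2\<close>)
  obtain h where h: "\<And>n. h n \<in> H" "\<And>n :: nat. h (Suc n) < h n" "h \<longlonglongrightarrow> 0"
    by (rule decreasing_sequence_to_islimpt[OF assms(9,10)]) (rule that)
  \<comment> \<open>The filter at 0 excludes the point 0 itself; positivity of the elements of H
    takes care of that.\<close>
  have filter: "filterlim h (at 0 within H) sequentially"
    unfolding filterlim_at using h(1,3) subsetD[OF assms(9) h(1)] by (auto simp: less_le)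
  have V: "V (h n) \<subseteq> H10 Om" "\<And>v w. v \<in> V (h n) \<Longrightarrow> w \<in> V (h n) \<Longrightarrow> (\<lambda>x. v x - w x) \<in> V (h n)" for n
  proof -
    have add: "\<forall>v\<in>V (h n). \<forall>w\<in>V (h n). (\<lambda>x. v x + w x) \<in> V (h n)"
      and cmult: "\<forall>c. \<forall>v\<in>V (h n). (\<lambda>x. c * v x) \<in> V (h n)"
      and sub: "V (h n) \<subseteq> H10 Om"
      using assms(11)[OF h(1)[of n]] by (simp_all add: findim_subspace_H10_def)
    show "V (h n) \<subseteq> H10 Om" by (rule sub)
    fix v w assume v: "v \<in> V (h n)" and w: "w \<in> V (h n)"
    have "(\<lambda>x. v x + (- 1) * w x) \<in> V (h n)"
      using add[rule_format, OF v cmult[rule_format, OF w, of "- 1"]] .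
    then show "(\<lambda>x. v x - w x) \<in> V (h n)" by simp
  qed
  obtain k u where k: "strict_mono (k :: nat \<Rightarrow> nat)" and u: "u \<in> H10 Om"
    and lim: "(\<lambda>n. H1_norm Om (\<lambda>x. uh (h (k n)) x - u x)) \<longlonglongrightarrow> 0"
    and sol: "\<And>w. w \<in> H10 Om \<Longrightarrow> form u u w = form_l L f w"
  proof (rule galerkin_strong_subsequence[of "\<lambda>n. V (h n)" "\<lambda>n. I (h n)" "\<lambda>n. uh (h n)"])
    show "I (h n) v \<in> V (h n)" if "v \<in> H10 Om" for n v
      by (rule assms(12)[OF h(1) that])
    show "(\<lambda>n. H1_norm Om (\<lambda>x. I (h n) v x - v x)) \<longlonglongrightarrow> 0" if "v \<in> H10 Om" for v
      by (rule filterlim_compose[OF assms(13)[OF that] filter])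
    show "uh (h n) \<in> V (h n)" for n
      by (rule assms(14)[OF h(1)])
    show "form (uh (h n)) (uh (h n)) v = form_l L f v" if v: "v \<in> V (h n)" for n v
    proof -
      have "uh (h n) \<in> H10 Om" "v \<in> H10 Om"
        using assms(14)[OF h(1)] v V(1) by blast+
      then show ?thesis
        using assms(15)[OF h(1) v] form by simp
    qed
    show "V (h n) \<subseteq> H10 Om" for n
      by (rule V(1))
    show "(\<lambda>x. v x - w x) \<in> V (h n)" if "v \<in> V (h n)" "w \<in> V (h n)" for n v w
      by (rule V(2)[OF that])
  qed (rule that)
  \<comment> \<open>The sign change makes the decreasing sequence increasing, so that monotonicity
    can be applied along k.\<close>
  have "strict_mono (\<lambda>n. - h n)"
    using h(2) by (simp add: strict_mono_Suc_iff)
  then have "h (k (Suc n)) < h (k n)" for n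
    using strict_monoD[of "\<lambda>n. - h n" "k n" "k (Suc n)"] strict_monoD[OF k, of n "Suc n"] by simp
  moreover have "(\<lambda>n. h (k n)) \<longlonglongrightarrow> 0"
    using LIMSEQ_subseq_LIMSEQ[OF h(3) k] by (simp add: o_def)
  moreover have "weakly_converges_H10 Om (\<lambda>n. uh (h (k n))) u"
    by (rule strong_imp_weakly_converges[OF subsetD[OF V(1) assms(14)[OF h(1)]] u lim])
  ultimately show ?thesis
    using h(1) u sol form[OF u u]
    by (intro exI[of _ "\<lambda>n. h (k n)"] exI[of _ u]) simp
qed

end
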